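(* Let $S\subseteq(0,\infty)$ be a near zero subsemigroup of $([0,\infty),+)$ and let $l\in\mathbb{N}$. Let "large near zero" be any one of "central near zero", "piecewise syndetic near zero", "$central^*$ near zero", "$PS^*$ near zero" or "$IP^*$ near zero". If $B\subseteq S$ is large near zero, then $\{(a,d)\in S\times S:\{a,a+d,\dots,a+(l-1)d\}\subseteq B\}\subseteq S\times S$ is large near zero.
   Context: $[0,\infty)$ and $[0,\infty)^2$ carry the usual Euclidean topology and (coordinatewise) addition. A subsemigroup $S\subseteq(0,\infty)$ is near zero if $0\in cl(S)$; for $S\times S$, "near zero" means near $(0,0)$. For such a semigroup $S$ in $T=[0,\infty)^k$ with idempotent $e=\overline 0$ and $\tau_e$ the neighborhoods of $e$: $\beta S$ is the set of ultrafilters on $S$ with $p+q=\{A:\{s:-s+A\in q\}\in p\}$, $-s+A=\{t\in S:s+t\in A\}$; $e_S^*=\{p\in\beta S: U\cap S\in p\ \forall U\in\tau_e\}$ with smallest ideal $K(e_S^* )$. $A\subseteq S$ is central near $e$ if $A\in p$ for some idempotent $p\in K(e_S^* )$; $central^*$ if it meets every central set near $e$. $A$ is piecewise syndetic near $e$ if, for a decreasing countable local base $\langle W_n\rangle$ at $e$, there are finite nonempty $F_n\subseteq W_n\cap S$ and $V_n\in\tau_e$, $V_n\subseteq W_n$, such that for every finite nonempty $G\subseteq S$ and $O\in\tau_e$ there is $x\in O\cap S$ with $(G\cap V_n)+x\subseteq\bigcup_{t\in F_n}(-t+A)$ for all $n$; $PS^*$ if it meets every piecewise syndetic set near $e$.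 $A$ is $IP$ near $e$ if there is a sequence $\langle x_n\rangle$ in $S$ such that for each $U\in\tau_e$ some tail has all its finite sums in $U$, and all finite sums $\sum_{n\in F}x_n$ ($F$ finite nonempty) lie in $A$; $IP^*$ if it meets every $IP$ set near $e$. *)

theory Defs
  imports "HOL-Analysis.Analysis"
begin

text \<open>
  Throughout, \<open>T\<close> is the ambient topological semigroup, given as a subset of a type carrying
  an addition and a topology, with idempotent \<open>e = 0\<close>. It is instantiated by \<open>{0..}\<close> in
  \<open>real\<close> and by \<open>{0..} \<times> {0..}\<close> in \<open>real \<times> real\<close>, where \<open>0 = (0, 0)\<close> and addition is
  coordinatewise.
\<close>

definition nbhds0 :: "'a::{topological_space, zero} set \<Rightarrow> 'a set set" where
  "nbhds0 T = {U. U \<subseteq> T \<and> (\<exists>V. openin (top_of_set T) V \<and> 0 \<in> V \<and> V \<subseteq> U)}"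

definition decreasing_base0 :: "'a::{topological_space, zero} set \<Rightarrow> (nat \<Rightarrow> 'a set) \<Rightarrow> bool" where
  "decreasing_base0 T W \<longleftrightarrow>
     (\<forall>n. W n \<in> nbhds0 T) \<and> decseq W \<and> (\<forall>U \<in> nbhds0 T. \<exists>n. W n \<subseteq> U)"

definition ultrafilters_on :: "'a set \<Rightarrow> 'a set set set" where
  "ultrafilters_on S = {p. p \<subseteq> Pow S \<and> S \<in> p \<and> {} \<notin> p \<and>
     (\<forall>A \<in> p. \<forall>B \<in> p. A \<inter> B \<in> p) \<and>
     (\<forall>A \<in> p. \<forall>B. A \<subseteq> B \<and> B \<subseteq> S \<longrightarrow> B \<in> p) \<and>
     (\<forall>A. A \<subseteq> S \<longrightarrow> A \<in> p \<or> S - A \<in> p)}"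

text \<open>\<open>translate S s A\<close> is the set \<open>-s + A\<close>.\<close>

definition translate :: "'a::plus set \<Rightarrow> 'a \<Rightarrow> 'a set \<Rightarrow> 'a set" where
  "translate S s A = {t \<in> S. s + t \<in> A}"

definition uf_add :: "'a::plus set \<Rightarrow> 'a set set \<Rightarrow> 'a set set \<Rightarrow> 'a set set" where
  "uf_add S p q = {A. A \<subseteq> S \<and> {s \<in> S. translate S s A \<in> q} \<in> p}"

definition ufs_near0 :: "'a::{topological_space, zero} set \<Rightarrow> 'a set \<Rightarrow> 'a set set set" where
  "ufs_near0 T S = {p \<in> ultrafilters_on S. \<forall>U \<in> nbhds0 T. U \<inter> S \<in> p}"

definition two_sided_ideal :: "('b \<Rightarrow> 'b \<Rightarrow> 'b) \<Rightarrow> 'b set \<Rightarrow> 'b set \<Rightarrow> bool" where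
  "two_sided_ideal f E I \<longleftrightarrow>
     I \<noteq> {} \<and> I \<subseteq> E \<and> (\<forall>x \<in> E. \<forall>y \<in> I. f x y \<in> I \<and> f y x \<in> I)"

text \<open>
  The smallest ideal, whenever one exists, is the intersection of all (nonempty, two-sided) ideals.
\<close>

definition smallest_ideal :: "('b \<Rightarrow> 'b \<Rightarrow> 'b) \<Rightarrow> 'b set \<Rightarrow> 'b set" where
  "smallest_ideal f E = \<Inter> {I. two_sided_ideal f E I}"

definition central_near0 ::
  "'a::{topological_space, monoid_add} set \<Rightarrow> 'a set \<Rightarrow> 'a set \<Rightarrow> bool" where
  "central_near0 T S A \<longleftrightarrow> A \<subseteq> S \<and>
     (\<exists>p \<in> smallest_ideal (uf_add S) (ufs_near0 T S). uf_add S p p = p \<and> A \<in> p)"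

text \<open>
  The property does not depend on the base \<open>W\<close>: given another base, pass to a subsequence of the
  \<open>F n\<close> and \<open>V n\<close>.
\<close>

definition ps_near0 ::
  "'a::{topological_space, monoid_add} set \<Rightarrow> 'a set \<Rightarrow> 'a set \<Rightarrow> bool" where
  "ps_near0 T S A \<longleftrightarrow> A \<subseteq> S \<and>
     (\<exists>W F V. decreasing_base0 T W \<and>
        (\<forall>n. finite (F n) \<and> F n \<noteq> {} \<and> F n \<subseteq> W n \<inter> S) \<and>
        (\<forall>n. V n \<in> nbhds0 T \<and> V n \<subseteq> W n) \<and>
        (\<forall>G U. finite G \<and> G \<noteq> {} \<and> G \<subseteq> S \<and> U \<in> nbhds0 T \<longrightarrow>
           (\<exists>x \<in> U \<inter> S. \<forall>n. (\<lambda>g. g + x) ` (G \<inter> V n) \<subseteq> (\<Union>t \<in> F n. translate S t A))))"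

definition ip_near0 ::
  "'a::{topological_space, comm_monoid_add} set \<Rightarrow> 'a set \<Rightarrow> 'a set \<Rightarrow> bool" where
  "ip_near0 T S A \<longleftrightarrow> A \<subseteq> S \<and>
     (\<exists>x :: nat \<Rightarrow> 'a. range x \<subseteq> S \<and>
        (\<forall>U \<in> nbhds0 T. \<exists>m. \<forall>F. finite F \<and> F \<noteq> {} \<and> F \<subseteq> {m..} \<longrightarrow> (\<Sum>n\<in>F. x n) \<in> U) \<and>
        (\<forall>F. finite F \<and> F \<noteq> {} \<longrightarrow> (\<Sum>n\<in>F. x n) \<in> A))"

text \<open>The dual \<open>P\<^sup>*\<close> of a notion \<open>P\<close> of largeness for subsets of \<open>S\<close>.\<close>

definition star :: "('a set \<Rightarrow> 'a set \<Rightarrow> 'a set \<Rightarrow> bool) \<Rightarrow> 'a set \<Rightarrow> 'a set \<Rightarrow> 'a set \<Rightarrow> bool" where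
  "star P T S A \<longleftrightarrow> A \<subseteq> S \<and> (\<forall>C. C \<subseteq> S \<and> P T S C \<longrightarrow> A \<inter> C \<noteq> {})"

definition ap_pairs :: "real set \<Rightarrow> nat \<Rightarrow> real set \<Rightarrow> (real \<times> real) set" where
  "ap_pairs S l B = {(a, d). a \<in> S \<and> d \<in> S \<and> (\<lambda>k. a + real k * d) ` {0..<l} \<subseteq> B}"

end

theory Submission
  imports Defs
begin

text \<open>
  Let \<open>E\<^sub>1\<close>, \<open>E\<^sub>2\<close> be the compact right topological semigroups of ultrafilters near zero on \<open>S\<close>
  and \<open>S \<times> S\<close>, with smallest ideals \<open>K\<^sub>1\<close>, \<open>K\<^sub>2\<close>, and let \<open>\<pi>\<^sub>k : E\<^sub>2 \<rightarrow> E\<^sub>1\<close> be the homomorphism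
  induced by \<open>(a, d) \<mapsto> a + k d\<close>. A set is piecewise syndetic near zero iff it belongs to some
  member of the smallest ideal, and IP near zero iff it belongs to some idempotent; so
  everything follows from two facts. First, \<open>\<pi>\<^sub>k\<close> maps \<open>K\<^sub>2\<close> into \<open>K\<^sub>1\<close>, because \<open>\<pi>\<^sub>k\<^sup>-\<^sup>1(K\<^sub>1)\<close> is an
  ideal of \<open>E\<^sub>2\<close>. Second, for every \<open>p \<in> K\<^sub>1\<close> there is \<open>q \<in> K\<^sub>2\<close> with \<open>\<pi>\<^sub>k(q) = p\<close> for all \<open>k\<close>
  simultaneously. For the latter, think of \<open>p\<close> as the ultrafilter \<open>p' = (p, 0)\<close>, which acts on
  \<open>E\<^sub>2\<close> from both sides and satisfies \<open>\<pi>\<^sub>k(p') = p\<close>. Choose a minimal left ideal \<open>L \<subseteq> E\<^sub>2 + p'\<close>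
  and an idempotent \<open>e \<in> L\<close>. Then \<open>\<pi>\<^sub>k(e)\<close> is an idempotent of the minimal left ideal \<open>E\<^sub>1 + p\<close>,
  hence a right identity there, and \<open>q = p' + e\<close> works.
\<close>

section \<open>Compact right topological semigroups\<close>

text \<open>Zorn's lemma is applied to the complements of the members below \<open>C0\<close>, so a
  maximal complement gives a minimal member. Compactness makes the intersection of a chain nonempty.
  Closure under intersections is asked only when they are nonempty, so that closed subsemigroups and
  closed left ideals both qualify.\<close>

lemma compact_space_minimal_closed:
  assumes X: "compact_space X"
    and \<C>: "\<And>C. C \<in> \<C> \<Longrightarrow> closedin X C \<and> C \<noteq> {}"
    and Inter: "\<And>\<D>. \<lbrakk>\<D> \<noteq> {}; \<D> \<subseteq> \<C>; \<Inter>\<D> \<noteq> {}\<rbrakk> \<Longrightarrow> \<Inter>\<D> \<in> \<C>"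
    and C0: "C0 \<in> \<C>"
  obtains M where "M \<in> \<C>" "M \<subseteq> C0" "\<And>C. \<lbrakk>C \<in> \<C>; C \<subseteq> M\<rbrakk> \<Longrightarrow> C = M"
proof -
  define \<A> where "\<A> = {topspace X - C |C. C \<in> \<C> \<and> C \<subseteq> C0}"
  have "\<exists>M\<in>\<A>. \<forall>Y\<in>\<A>. M \<subseteq> Y \<longrightarrow> Y = M"
  proof (rule subset_Zorn_nonempty)
    show "\<A> \<noteq> {}"
      using C0 by (auto simp: \<A>_def)
    fix \<E> assume ne: "\<E> \<noteq> {}" and ch: "subset.chain \<A> \<E>"
    define \<D> where "\<D> = (\<lambda>E. topspace X - E) ` \<E>"
    have sub: "\<E> \<subseteq> \<A>" and tot: "\<And>D E. \<lbrakk>D \<in> \<E>; E \<in> \<E>\<rbrakk> \<Longrightarrow> D \<subseteq> E \<or> E \<subseteq> D"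
      using ch by (auto simp: subset_chain_def)
    have \<D>: "\<D> \<subseteq> {C \<in> \<C>. C \<subseteq> C0}"
    proof
      fix D assume "D \<in> \<D>"
      then obtain C where C: "C \<in> \<C>" "C \<subseteq> C0" and D: "D = topspace X - (topspace X - C)"
        using sub by (auto simp: \<D>_def \<A>_def)
      have "C \<subseteq> topspace X"
        using \<C> C(1) closedin_subset by blast
      then show "D \<in> {C \<in> \<C>. C \<subseteq> C0}"
        using C D by (simp add: double_diff)
    qed
    have \<D>_chain: "D \<subseteq> E \<or> E \<subseteq> D" if DE: "D \<in> \<D>" "E \<in> \<D>" for D E
    proof -
      obtain D' E' where "D' \<in> \<E>" "E' \<in> \<E>" "D = topspace X - D'" "E = topspace X - E'"
        using DE unfolding \<D>_def by blast
      then show ?thesis using tot[of D' E'] by blast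
    qed
    \<comment> \<open>A finite nonempty subfamily of a chain contains its own intersection; this
      yields the finite intersection property.\<close>
    have fin: "\<Inter>\<F> \<in> \<F>" if "finite \<F>" "\<F> \<noteq> {}" "\<F> \<subseteq> \<D>" for \<F>
      using that
    proof (induction rule: finite_ne_induct)
      case (insert D \<F>)
      then have I: "\<Inter>\<F> \<in> \<F>" and "D \<in> \<D>" by simp_all
      moreover from I insert.prems have "\<Inter>\<F> \<in> \<D>" by blast
      ultimately have "D \<subseteq> \<Inter>\<F> \<or> \<Inter>\<F> \<subseteq> D"
        using \<D>_chain by blast
      then show ?case
      proof
        assume "D \<subseteq> \<Inter>\<F>"
        then have "\<Inter>(insert D \<F>) = D" by auto
        then show ?thesis by simp
      next
        assume "\<Inter>\<F> \<subseteq> D"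
        then have "\<Inter>(insert D \<F>) = \<Inter>\<F>" by auto
        then show ?thesis using I by simp
      qed
    qed auto
    have "\<Inter>\<D> \<noteq> {}"
    proof -
      have "\<Inter>\<F> \<noteq> {}" if "finite \<F>" "\<F> \<subseteq> \<D>" for \<F>
      proof (cases "\<F> = {}")
        case False
        then have "\<Inter>\<F> \<in> \<C>" using fin[OF that(1) False that(2)] that(2) \<D> by blast
        then show ?thesis using \<C> by blast
      qed simp
      moreover have "\<forall>C\<in>\<D>. closedin X C"
        using \<D> \<C> by blast
      ultimately show ?thesis
        using X[unfolded compact_space_fip, rule_format, of \<D>] by simp
    qed
    moreover have "\<D> \<noteq> {}"
      using ne by (simp add: \<D>_def)
    moreover have "\<D> \<subseteq> \<C>" using \<D> by blast
    ultimately have "\<Inter>\<D> \<in> \<C>"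
      using Inter by blast
    moreover have "\<Inter>\<D> \<subseteq> C0"
      using \<D> \<open>\<D> \<noteq> {}\<close> by blast
    moreover have "\<Union>\<E> = topspace X - \<Inter>\<D>"
      using sub by (auto simp: \<D>_def \<A>_def)
    ultimately show "\<Union>\<E> \<in> \<A>"
      by (auto simp: \<A>_def)
  qed
  then obtain N where "N \<in> \<A>" and N: "\<And>Y. \<lbrakk>Y \<in> \<A>; N \<subseteq> Y\<rbrakk> \<Longrightarrow> Y = N"
    by blast
  then obtain M where M: "M \<in> \<C>" "M \<subseteq> C0" "N = topspace X - M"
    unfolding \<A>_def by blast
  have max: "topspace X - C = topspace X - M"
    if "C \<in> \<C>" "C \<subseteq> C0" "topspace X - M \<subseteq> topspace X - C" for C
  proof -
    have "topspace X - C \<in> \<A>" using that unfolding \<A>_def by blast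
    then show ?thesis using N M(3) that(3) by simp
  qed
  have "C = M" if "C \<in> \<C>" "C \<subseteq> M" for C
  proof -
    have "topspace X - C = topspace X - M"
      using that M by (intro max) auto
    moreover have "C \<subseteq> topspace X" "M \<subseteq> topspace X"
      using \<C> M(1) that(1) closedin_subset by blast+
    ultimately show ?thesis by (metis double_diff subset_refl)
  qed
  then show ?thesis using M that by blast
qed

locale compact_right_topological_semigroup =
  fixes X :: "'b topology" and f :: "'b \<Rightarrow> 'b \<Rightarrow> 'b" (infixl \<open>\<odot>\<close> 70)
  assumes compact: "compact_space X"
    and Hausdorff: "Hausdorff_space X"
    and nonempty: "topspace X \<noteq> {}"
    and closed: "\<lbrakk>x \<in> topspace X; y \<in> topspace X\<rbrakk> \<Longrightarrow> x \<odot> y \<in> topspace X"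
    and assoc: "\<lbrakk>x \<in> topspace X; y \<in> topspace X; z \<in> topspace X\<rbrakk> \<Longrightarrow> x \<odot> y \<odot> z = x \<odot> (y \<odot> z)"
    and continuous: "y \<in> topspace X \<Longrightarrow> continuous_map X X (\<lambda>x. x \<odot> y)"
begin

lemma closedin_image: "\<lbrakk>closedin X C; y \<in> topspace X\<rbrakk> \<Longrightarrow> closedin X ((\<lambda>x. x \<odot> y) ` C)"
  using compactin_imp_closedin[OF Hausdorff image_compactin[OF closedin_compact_space[OF compact]
        continuous]] .

text \<open>The Ellis-Numakura argument. In a minimal closed subsemigroup \<open>M\<close> any
  \<open>e\<close> works: minimality gives first \<open>M \<odot> e = M\<close> and then that every
  element of \<open>M\<close> solves \<open>x \<odot> e = e\<close>, in particular \<open>e\<close>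
  itself.\<close>

lemma idempotent_exists:
  assumes C: "closedin X C" "C \<noteq> {}" and mult: "\<And>x y. \<lbrakk>x \<in> C; y \<in> C\<rbrakk> \<Longrightarrow> x \<odot> y \<in> C"
  obtains e where "e \<in> C" "e \<odot> e = e"
proof -
  define \<C> where "\<C> = {D. closedin X D \<and> D \<noteq> {} \<and> (\<forall>x\<in>D. \<forall>y\<in>D. x \<odot> y \<in> D)}"
  obtain M where M: "M \<in> \<C>" "M \<subseteq> C" and min: "\<And>D. \<lbrakk>D \<in> \<C>; D \<subseteq> M\<rbrakk> \<Longrightarrow> D = M"
  proof (rule compact_space_minimal_closed[OF compact, of \<C> C])
    show "\<Inter>\<D> \<in> \<C>" if "\<D> \<noteq> {}" "\<D> \<subseteq> \<C>" "\<Inter>\<D> \<noteq> {}" for \<D>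
      using that by (auto simp: \<C>_def intro!: closedin_Inter)
  qed (use assms in \<open>auto simp: \<C>_def\<close>)
  obtain e where e: "e \<in> M" using M by (auto simp: \<C>_def)
  have Mc: "closedin X M" and Mm: "\<And>x y. \<lbrakk>x \<in> M; y \<in> M\<rbrakk> \<Longrightarrow> x \<odot> y \<in> M"
    using M by (auto simp: \<C>_def)
  have MX: "M \<subseteq> topspace X" using Mc closedin_subset by blast
  have "(\<lambda>x. x \<odot> e) ` M = M"
  proof (rule min)
    have "(x \<odot> e) \<odot> (y \<odot> e) \<in> (\<lambda>x. x \<odot> e) ` M" if "x \<in> M" "y \<in> M" for x y
    proof -
      have "(x \<odot> e) \<odot> (y \<odot> e) = (x \<odot> e \<odot> y) \<odot> e"
        using that e MX assoc closed by (metis in_mono)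
      then show ?thesis using that e Mm by blast
    qed
    then show "(\<lambda>x. x \<odot> e) ` M \<in> \<C>"
      using closedin_image[OF Mc] e MX by (auto simp: \<C>_def)
  qed (use Mm e in blast)
  then obtain x where x: "x \<in> M" "x \<odot> e = e" using e by (metis imageE)
  \<comment> \<open>The solutions of \<open>x \<odot> e = e\<close> form a point preimage under a
    continuous map, hence a closed set; \<open>x\<close> above shows that it meets
    \<open>M\<close>.\<close>
  define D where "D = {x \<in> topspace X. x \<odot> e \<in> {e}} \<inter> M"
  have "D = M"
  proof (rule min)
    have "closedin X {e}"
      using Hausdorff e MX by (simp add: closedin_Hausdorff_singleton subset_iff)
    then have "closedin X D"
      unfolding D_def using continuous[of e] e MX Mc
      by (intro closedin_Int closedin_continuous_map_preimage) auto
    moreover have "a \<odot> b \<odot> e = e" if "a \<in> M" "b \<in> M" "a \<odot> e = e" "b \<odot> e = e" for a b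
      using that e MX assoc by (metis in_mono)
    ultimately show "D \<in> \<C>"
      using x Mm MX closed by (auto simp: \<C>_def D_def)
  qed (simp add: D_def)
  then have "e \<odot> e = e" using e by (auto simp: D_def)
  then show ?thesis using that e M(2) by blast
qed

section \<open>Minimal left ideals and the smallest ideal\<close>

definition left_ideal :: "'b set \<Rightarrow> bool" where
  "left_ideal L \<longleftrightarrow> L \<noteq> {} \<and> L \<subseteq> topspace X \<and> (\<forall>x\<in>topspace X. \<forall>y\<in>L. x \<odot> y \<in> L)"

definition minimal_left_ideal :: "'b set \<Rightarrow> bool" where
  "minimal_left_ideal L \<longleftrightarrow> left_ideal L \<and> (\<forall>L'. left_ideal L' \<and> L' \<subseteq> L \<longrightarrow> L' = L)"

lemma minimal_left_ideal_nonempty: "minimal_left_ideal L \<Longrightarrow> L \<noteq> {}"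
  and minimal_left_ideal_subset_topspace: "minimal_left_ideal L \<Longrightarrow> L \<subseteq> topspace X"
  by (simp_all add: minimal_left_ideal_def left_ideal_def)

lemma left_ideal_principal: "x \<in> topspace X \<Longrightarrow> left_ideal ((\<lambda>y. y \<odot> x) ` topspace X)"
  using nonempty closed by (auto simp: left_ideal_def assoc[symmetric])

lemma minimal_left_ideal_eq:
  assumes L: "minimal_left_ideal L" and x: "x \<in> L"
  shows "L = (\<lambda>y. y \<odot> x) ` topspace X"
proof -
  have "x \<in> topspace X" "(\<lambda>y. y \<odot> x) ` topspace X \<subseteq> L"
    using L x by (auto simp: minimal_left_ideal_def left_ideal_def)
  then show ?thesis
    using L left_ideal_principal by (auto simp: minimal_left_ideal_def)
qed

lemma closedin_minimal_left_ideal: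
  assumes "minimal_left_ideal L"
  shows "closedin X L"
proof -
  obtain x where x: "x \<in> L" "x \<in> topspace X"
    using assms by (auto simp: minimal_left_ideal_def left_ideal_def)
  then show ?thesis
    using minimal_left_ideal_eq[OF assms x(1)] closedin_image[of "topspace X" x] by simp
qed

text \<open>Left ideals need not be closed, but principal ones are, as continuous images of a
  compact space. The minimality argument therefore runs among closed left ideals, starting from a
  principal one inside \<open>L\<close>.\<close>

lemma minimal_left_ideal_exists:
  assumes L: "left_ideal L"
  obtains M where "minimal_left_ideal M" "M \<subseteq> L"
proof -
  obtain x where x: "x \<in> L" "x \<in> topspace X" using L by (auto simp: left_ideal_def)
  define \<C> where "\<C> = {L. closedin X L \<and> left_ideal L}"
  define C where "C = (\<lambda>y. y \<odot> x) ` topspace X"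
  have CL: "C \<subseteq> L" using L x by (auto simp: C_def left_ideal_def)
  obtain M where M: "M \<in> \<C>" "M \<subseteq> C" and min: "\<And>D. \<lbrakk>D \<in> \<C>; D \<subseteq> M\<rbrakk> \<Longrightarrow> D = M"
  proof (rule compact_space_minimal_closed[OF compact, of \<C> C])
    show "\<Inter>\<D> \<in> \<C>" if "\<D> \<noteq> {}" "\<D> \<subseteq> \<C>" "\<Inter>\<D> \<noteq> {}" for \<D>
    proof -
      have cl: "closedin X D" and li: "left_ideal D" if "D \<in> \<D>" for D
        using that \<open>\<D> \<subseteq> \<C>\<close> by (auto simp: \<C>_def)
      have "closedin X (\<Inter>\<D>)" using \<open>\<D> \<noteq> {}\<close> cl by (rule closedin_Inter)
      moreover from this have "left_ideal (\<Inter>\<D>)"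
        using \<open>\<Inter>\<D> \<noteq> {}\<close> closedin_subset li by (simp add: left_ideal_def)
      ultimately show ?thesis by (simp add: \<C>_def)
    qed
    show "C \<in> \<C>"
      using left_ideal_principal[OF x(2)] closedin_image[OF closedin_topspace x(2)]
      by (simp add: \<C>_def C_def)
    show "closedin X D \<and> D \<noteq> {}" if "D \<in> \<C>" for D
      using that by (simp add: \<C>_def left_ideal_def)
  qed auto
  \<comment> \<open>So far \<open>M\<close> is minimal only among closed left ideals. An arbitrary
    left ideal inside \<open>M\<close> contains a closed principal one, which must already be all of
    \<open>M\<close>.\<close>
  have "L' = M" if L': "left_ideal L'" "L' \<subseteq> M" for L'
  proof -
    obtain y where y: "y \<in> L'" "y \<in> topspace X" using L' by (auto simp: left_ideal_def)
    have "(\<lambda>z. z \<odot> y) ` topspace X \<subseteq> L'"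
      using L' y by (auto simp: left_ideal_def)
    moreover from this have "(\<lambda>z. z \<odot> y) ` topspace X = M"
      using left_ideal_principal[OF y(2)] closedin_image[OF closedin_topspace y(2)] L'(2)
      by (intro min) (simp_all add: \<C>_def)
    ultimately show ?thesis using L'(2) by blast
  qed
  then have "minimal_left_ideal M"
    using M by (auto simp: minimal_left_ideal_def \<C>_def)
  then show ?thesis using that M CL by blast
qed

text \<open>A left ideal inside the translate pulls back along
  \<open>y \<mapsto> y \<odot> x\<close> to a left ideal inside \<open>L\<close>, which is all of
  \<open>L\<close>. This makes the union of the minimal left ideals stable under multiplication on
  the right.\<close>

lemma minimal_left_ideal_translate:
  assumes L: "minimal_left_ideal L" and x: "x \<in> topspace X"
  shows "minimal_left_ideal ((\<lambda>y. y \<odot> x) ` L)"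
proof -
  have li: "left_ideal L" and LX: "L \<subseteq> topspace X"
    using L by (auto simp: minimal_left_ideal_def left_ideal_def)
  have "left_ideal ((\<lambda>y. y \<odot> x) ` L)"
    unfolding left_ideal_def
  proof (intro conjI ballI)
    fix z w assume z: "z \<in> topspace X" and "w \<in> (\<lambda>y. y \<odot> x) ` L"
    then obtain y where y: "y \<in> L" "w = y \<odot> x" by blast
    then have "z \<odot> w = (z \<odot> y) \<odot> x" "z \<odot> y \<in> L"
      using assoc[of z y x] z x LX li by (auto simp: left_ideal_def)
    then show "z \<odot> w \<in> (\<lambda>y. y \<odot> x) ` L" by blast
  qed (use li LX x closed in \<open>auto simp: left_ideal_def\<close>)
  moreover have "L' = (\<lambda>y. y \<odot> x) ` L" if L': "left_ideal L'" "L' \<subseteq> (\<lambda>y. y \<odot> x) ` L" for L'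
  proof -
    define D where "D = {y \<in> L. y \<odot> x \<in> L'}"
    have "left_ideal D"
      using li L' x LX by (auto simp: left_ideal_def D_def assoc subset_iff)
    then have "D = L" using L by (auto simp: minimal_left_ideal_def D_def)
    then show ?thesis using L' by (auto simp: D_def)
  qed
  ultimately show ?thesis by (auto simp: minimal_left_ideal_def)
qed

text \<open>A product of an element of \<open>I\<close> with one of \<open>L\<close> lies in both,
  so \<open>L \<inter> I\<close> is a left ideal inside \<open>L\<close>.\<close>

lemma minimal_left_ideal_subset_ideal:
  assumes L: "minimal_left_ideal L" and I: "two_sided_ideal f (topspace X) I"
  shows "L \<subseteq> I"
proof -
  obtain x y where xy: "x \<in> I" "y \<in> L" "x \<in> topspace X" "y \<in> topspace X"
    using L I by (auto simp: minimal_left_ideal_def left_ideal_def two_sided_ideal_def)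
  have "x \<odot> y \<in> L \<inter> I"
    using L I xy by (auto simp: minimal_left_ideal_def left_ideal_def two_sided_ideal_def)
  moreover from this have "left_ideal (L \<inter> I)"
    using L I by (auto simp: minimal_left_ideal_def left_ideal_def two_sided_ideal_def)
  ultimately show ?thesis
    using L by (auto simp: minimal_left_ideal_def)
qed

lemma two_sided_ideal_Union_minimal_left_ideals:
  "two_sided_ideal f (topspace X) (\<Union>{L. minimal_left_ideal L})"
proof -
  have "left_ideal (topspace X)"
    using nonempty closed by (simp add: left_ideal_def)
  then obtain M where "minimal_left_ideal M"
    using minimal_left_ideal_exists by blast
  then have "\<Union>{L. minimal_left_ideal L} \<noteq> {}"
    using minimal_left_ideal_nonempty by blast
  moreover have "\<Union>{L. minimal_left_ideal L} \<subseteq> topspace X"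
    using minimal_left_ideal_subset_topspace by blast
  moreover have "x \<odot> y \<in> \<Union>{L. minimal_left_ideal L} \<and> y \<odot> x \<in> \<Union>{L. minimal_left_ideal L}"
    if "x \<in> topspace X" "y \<in> \<Union>{L. minimal_left_ideal L}" for x y
  proof -
    obtain L where L: "minimal_left_ideal L" "y \<in> L" using \<open>y \<in> _\<close> by blast
    have "x \<odot> y \<in> L" using L \<open>x \<in> _\<close> by (auto simp: minimal_left_ideal_def left_ideal_def)
    then show ?thesis
      using L minimal_left_ideal_translate[OF L(1) \<open>x \<in> _\<close>] by blast
  qed
  ultimately show ?thesis
    unfolding two_sided_ideal_def by (intro conjI ballI) simp_all
qed

text \<open>The union on the right is itself an ideal and is contained in every ideal. Membership in
  the smallest ideal thus becomes membership in some minimal left ideal.\<close>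

lemma smallest_ideal_eq: "smallest_ideal f (topspace X) = \<Union>{L. minimal_left_ideal L}"
  unfolding smallest_ideal_def
proof
  show "\<Inter>{I. two_sided_ideal f (topspace X) I} \<subseteq> \<Union>{L. minimal_left_ideal L}"
    using two_sided_ideal_Union_minimal_left_ideals by (intro Inter_lower) simp
  show "\<Union>{L. minimal_left_ideal L} \<subseteq> \<Inter>{I. two_sided_ideal f (topspace X) I}"
    using minimal_left_ideal_subset_ideal by (intro Union_least Inter_greatest) simp
qed

lemma two_sided_ideal_smallest_ideal:
  "two_sided_ideal f (topspace X) (smallest_ideal f (topspace X))"
  using two_sided_ideal_Union_minimal_left_ideals by (simp add: smallest_ideal_eq)

lemma smallest_ideal_subset: "smallest_ideal f (topspace X) \<subseteq> topspace X"
  using two_sided_ideal_smallest_ideal by (auto simp: two_sided_ideal_def)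

text \<open>Minimality makes \<open>L\<close> the principal left ideal of \<open>e\<close>, so
  \<open>x\<close> has the form \<open>y \<odot> e\<close> and absorbs a further
  \<open>e\<close>.\<close>

lemma idempotent_right_identity:
  assumes L: "minimal_left_ideal L" and e: "e \<in> L" "e \<odot> e = e" and x: "x \<in> L"
  shows "x \<odot> e = x"
proof -
  have eX: "e \<in> topspace X" using L e by (auto simp: minimal_left_ideal_def left_ideal_def)
  obtain y where "y \<in> topspace X" "x = y \<odot> e"
    using minimal_left_ideal_eq[OF L e(1)] x by blast
  then show ?thesis using assoc eX e(2) by simp
qed

end

section \<open>Spaces of ultrafilters\<close>

lemma ultrafilters_onD:
  assumes "p \<in> ultrafilters_on S"
  shows uf_subset: "A \<in> p \<Longrightarrow> A \<subseteq> S"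
    and uf_top: "S \<in> p"
    and uf_nonempty: "A \<in> p \<Longrightarrow> A \<noteq> {}"
    and uf_Int: "\<lbrakk>A \<in> p; B \<in> p\<rbrakk> \<Longrightarrow> A \<inter> B \<in> p"
    and uf_mono: "\<lbrakk>A \<in> p; A \<subseteq> B; B \<subseteq> S\<rbrakk> \<Longrightarrow> B \<in> p"
  using assms unfolding ultrafilters_on_def by blast+

lemma uf_Diff_iff:
  assumes p: "p \<in> ultrafilters_on S" and A: "A \<subseteq> S"
  shows "S - A \<in> p \<longleftrightarrow> A \<notin> p"
proof
  show "A \<notin> p" if "S - A \<in> p"
  proof
    assume "A \<in> p"
    from uf_Int[OF p that this] have "(S - A) \<inter> A \<in> p" .
    then show False using uf_nonempty[OF p] by blast
  qed
  show "S - A \<in> p" if "A \<notin> p"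
    using p A that unfolding ultrafilters_on_def by blast
qed

lemma uf_Int_iff:
  assumes p: "p \<in> ultrafilters_on S" and "A \<subseteq> S" "B \<subseteq> S"
  shows "A \<inter> B \<in> p \<longleftrightarrow> A \<in> p \<and> B \<in> p"
  using uf_Int[OF p] uf_mono[OF p, of "A \<inter> B"] assms(2,3) by blast

lemma uf_UN:
  assumes p: "p \<in> ultrafilters_on S" and "finite I" "\<And>i. i \<in> I \<Longrightarrow> A i \<subseteq> S" "(\<Union>i\<in>I. A i) \<in> p"
  shows "\<exists>i\<in>I. A i \<in> p"
  using assms(2-4)
proof (induction rule: finite_induct)
  case empty
  then show ?case using uf_nonempty[OF p, of "{}"] by simp
next
  case (insert i I)
  show ?case
  proof (cases "A i \<in> p")
    case False
    then have "S - A i \<in> p" using uf_Diff_iff[OF p] insert.prems(1) by blast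
    then have "(\<Union>j\<in>insert i I. A j) \<inter> (S - A i) \<in> p"
      using insert.prems(2) uf_Int[OF p] by simp
    then have "(\<Union>j\<in>I. A j) \<in> p"
      by (rule uf_mono[OF p]) (use insert.prems(1) in auto)
    then show ?thesis using insert.IH insert.prems(1) by blast
  qed blast
qed

lemma uf_INT:
  assumes p: "p \<in> ultrafilters_on S" and "finite I" "\<And>i. i \<in> I \<Longrightarrow> A i \<in> p"
  shows "S \<inter> (\<Inter>i\<in>I. A i) \<in> p"
  using assms(2,3)
proof (induction rule: finite_induct)
  case (insert i I)
  have "S \<inter> (\<Inter>j\<in>insert i I. A j) = A i \<inter> (S \<inter> (\<Inter>j\<in>I. A j))" by blast
  then show ?case using insert uf_Int[OF p] by simp
qed (simp add: uf_top[OF p])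

lemma uf_eqI:
  assumes p: "p \<in> ultrafilters_on S" and q: "q \<in> ultrafilters_on S" and "p \<subseteq> q"
  shows "p = q"
proof
  show "q \<subseteq> p"
  proof
    fix A assume A: "A \<in> q"
    then show "A \<in> p"
      using uf_Diff_iff[OF p, of A] uf_Diff_iff[OF q, of A] uf_subset[OF q A] \<open>p \<subseteq> q\<close> by blast
  qed
qed fact

lemma ultrafilters_onI:
  assumes "p \<subseteq> Pow S" "S \<in> p"
    and Int: "\<And>A B. \<lbrakk>A \<subseteq> S; B \<subseteq> S\<rbrakk> \<Longrightarrow> A \<inter> B \<in> p \<longleftrightarrow> A \<in> p \<and> B \<in> p"
    and Diff: "\<And>A. A \<subseteq> S \<Longrightarrow> S - A \<in> p \<longleftrightarrow> A \<notin> p"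
  shows "p \<in> ultrafilters_on S"
proof -
  have "{} \<notin> p" using Diff[of S] \<open>S \<in> p\<close> by simp
  moreover have "B \<in> p" if "A \<in> p" "A \<subseteq> B" "B \<subseteq> S" for A B
    using Int[of A B] that by (simp add: Int_absorb2)
  moreover have "A \<inter> B \<in> p" if "A \<in> p" "B \<in> p" for A B
    using Int[of A B] that \<open>p \<subseteq> Pow S\<close> by (simp add: subset_iff)
  moreover have "A \<in> p \<or> S - A \<in> p" if "A \<subseteq> S" for A
    using Diff[OF that] by simp
  ultimately show ?thesis
    using assms(1,2) unfolding ultrafilters_on_def by simp
qed

text \<open>Zorn's lemma gives a maximal family with the finite intersection property that extends
  \<open>\<F>\<close>; maximality forces it to be an ultrafilter.\<close>

lemma ultrafilter_exists_fip:
  assumes \<F>: "\<F> \<subseteq> Pow S" and fip: "\<And>\<G>. \<lbrakk>finite \<G>; \<G> \<subseteq> \<F>\<rbrakk> \<Longrightarrow> S \<inter> \<Inter>\<G> \<noteq> {}"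
  shows "\<exists>p\<in>ultrafilters_on S. \<F> \<subseteq> p"
proof -
  define FIP where "FIP \<M> \<longleftrightarrow> (\<forall>\<G>. finite \<G> \<and> \<G> \<subseteq> \<M> \<longrightarrow> S \<inter> \<Inter>\<G> \<noteq> {})" for \<M>
  define \<A> where "\<A> = {\<M>. \<F> \<subseteq> \<M> \<and> \<M> \<subseteq> Pow S \<and> FIP \<M>}"
  have "\<exists>M\<in>\<A>. \<forall>Y\<in>\<A>. M \<subseteq> Y \<longrightarrow> Y = M"
  proof (rule subset_Zorn_nonempty)
    have "FIP \<F>" unfolding FIP_def by (intro allI impI, elim conjE, rule fip)
    then have "\<F> \<in> \<A>" using \<F> by (simp add: \<A>_def)
    then show "\<A> \<noteq> {}" by blast
    fix \<C> assume \<C>: "\<C> \<noteq> {}" "subset.chain \<A> \<C>"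
    have "FIP (\<Union>\<C>)"
      unfolding FIP_def
    proof (intro allI impI, elim conjE)
      fix \<G> assume \<G>: "finite \<G>" "\<G> \<subseteq> \<Union>\<C>"
      obtain \<M> where "\<M> \<in> \<C>" "\<G> \<subseteq> \<M>"
        using finite_subset_Union_chain[OF \<G> \<C>] by blast
      moreover from this have "FIP \<M>"
        using \<C>(2) unfolding \<A>_def subset_chain_def by blast
      ultimately show "S \<inter> \<Inter>\<G> \<noteq> {}"
        using \<G>(1) unfolding FIP_def by (metis (no_types))
    qed
    moreover have "\<F> \<subseteq> \<M> \<and> \<M> \<subseteq> Pow S" if "\<M> \<in> \<C>" for \<M>
      using \<C>(2) that unfolding \<A>_def subset_chain_def by blast
    then have "\<F> \<subseteq> \<Union>\<C>" "\<Union>\<C> \<subseteq> Pow S"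
      using \<C>(1) Union_upper[of _ \<C>] Union_least[of \<C> "Pow S"]
      by (metis all_not_in_conv subset_trans)+
    ultimately show "\<Union>\<C> \<in> \<A>" by (simp add: \<A>_def)
  qed
  then obtain M where M: "M \<in> \<A>" and max: "\<And>Y. \<lbrakk>Y \<in> \<A>; M \<subseteq> Y\<rbrakk> \<Longrightarrow> Y = M" by blast
  have MS: "\<F> \<subseteq> M" "M \<subseteq> Pow S" and "FIP M"
    using M by (simp_all add: \<A>_def)
  then have Mfip: "S \<inter> \<Inter>\<G> \<noteq> {}" if "finite \<G>" "\<G> \<subseteq> M" for \<G>
    using that unfolding FIP_def by iprover
  have insertM: "A \<in> M" if "A \<subseteq> S" "FIP (insert A M)" for A
  proof -
    have "insert A M \<in> \<A>" using that MS by (simp add: \<A>_def subset_insertI2)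
    then show ?thesis using max[of "insert A M"] by blast
  qed
  \<comment> \<open>The maximal family absorbs every subset of \<open>S\<close> that contains a
    finite intersection of its members. All the filter axioms are instances of this.\<close>
  have up: "A \<in> M" if A: "A \<subseteq> S" "finite \<H>" "\<H> \<subseteq> M" "S \<inter> \<Inter>\<H> \<subseteq> A" for A \<H>
  proof (rule insertM[OF A(1)], unfold FIP_def, intro allI impI, elim conjE)
    fix \<G> assume "finite \<G>" "\<G> \<subseteq> insert A M"
    then have "finite (\<H> \<union> (\<G> - {A}))" "\<H> \<union> (\<G> - {A}) \<subseteq> M"
      using A(2,3) by auto
    then have "S \<inter> \<Inter>(\<H> \<union> (\<G> - {A})) \<noteq> {}"
      by (rule Mfip)
    moreover have "S \<inter> \<Inter>(\<H> \<union> (\<G> - {A})) \<subseteq> S \<inter> \<Inter>\<G>"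
    proof
      fix x assume x: "x \<in> S \<inter> \<Inter>(\<H> \<union> (\<G> - {A}))"
      then have "x \<in> A" using A(4) by auto
      then show "x \<in> S \<inter> \<Inter>\<G>" using x by auto
    qed
    ultimately show "S \<inter> \<Inter>\<G> \<noteq> {}" by blast
  qed
  have "M \<in> ultrafilters_on S"
    unfolding ultrafilters_on_def
  proof (intro CollectI conjI ballI allI impI)
    show "S \<in> M" by (rule up[of S "{}"]) auto
    show "{} \<notin> M" using Mfip[of "{{}}"] by auto
    show "A \<inter> B \<in> M" if "A \<in> M" "B \<in> M" for A B
      using that MS by (intro up[of "A \<inter> B" "{A, B}"]) auto
    show "B \<in> M" if "A \<in> M" "A \<subseteq> B \<and> B \<subseteq> S" for A B
      using that by (intro up[of B "{A}"]) auto
    show "A \<in> M \<or> S - A \<in> M" if A: "A \<subseteq> S" for A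
    proof (cases "FIP (insert A M)")
      \<comment> \<open>A finite \<open>\<G>\<close> witnesses that \<open>A\<close> is incompatible
        with \<open>M\<close>. Without \<open>A\<close> it consists of members of \<open>M\<close>
        whose intersection avoids \<open>A\<close>.\<close>
      case False
      then obtain \<G> where \<G>: "finite \<G>" "\<G> \<subseteq> insert A M" "S \<inter> \<Inter>\<G> = {}"
        unfolding FIP_def by blast
      then have "S - A \<in> M"
        by (intro up[of "S - A" "\<G> - {A}"]) auto
      then show ?thesis ..
    qed (use insertM A in blast)
  qed (use MS in blast)
  then show ?thesis using MS(1) by blast
qed

lemma ultrafilter_exists_filter_base:
  assumes \<B>: "\<B> \<subseteq> Pow S" "\<B> \<noteq> {}" "{} \<notin> \<B>"
    and dir: "\<And>A B. \<lbrakk>A \<in> \<B>; B \<in> \<B>\<rbrakk> \<Longrightarrow> \<exists>C\<in>\<B>. C \<subseteq> A \<inter> B"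
  shows "\<exists>p\<in>ultrafilters_on S. \<B> \<subseteq> p"
proof (rule ultrafilter_exists_fip[OF \<B>(1)])
  fix \<G> assume "finite \<G>" "\<G> \<subseteq> \<B>"
  then have "\<exists>C\<in>\<B>. C \<subseteq> \<Inter>\<G>"
  proof (induction rule: finite_induct)
    case empty
    then show ?case using \<B>(2) by auto
  next
    case (insert A \<G>)
    then obtain C where C: "C \<in> \<B>" "C \<subseteq> \<Inter>\<G>" by auto
    obtain D where "D \<in> \<B>" "D \<subseteq> A \<inter> C"
      using dir[OF _ C(1), of A] insert.prems by blast
    then show ?case using C(2) by blast
  qed
  then obtain C where "C \<in> \<B>" "C \<subseteq> \<Inter>\<G>" by blast
  moreover have "C \<noteq> {}" "C \<subseteq> S" using \<B> \<open>C \<in> \<B>\<close> by auto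
  ultimately show "S \<inter> \<Inter>\<G> \<noteq> {}" by blast
qed

section \<open>The compact Hausdorff topology on the set of ultrafilters\<close>

definition uf_basic :: "'a set \<Rightarrow> 'a set \<Rightarrow> 'a set set set" where
  "uf_basic S A = {p \<in> ultrafilters_on S. A \<in> p}"

lemma uf_basicI: "\<lbrakk>p \<in> ultrafilters_on S; A \<in> p\<rbrakk> \<Longrightarrow> p \<in> uf_basic S A"
  by (simp add: uf_basic_def)

lemma uf_basic_subset: "uf_basic S A \<subseteq> ultrafilters_on S"
  by (auto simp: uf_basic_def)

lemma uf_basic_Int:
  assumes "A \<subseteq> S" "B \<subseteq> S"
  shows "uf_basic S (A \<inter> B) = uf_basic S A \<inter> uf_basic S B"
  using uf_Int_iff[OF _ assms] by (auto simp: uf_basic_def)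

text \<open>This is the topology of the Stone-Cech compactification of the discrete set
  \<open>S\<close>; the sets \<open>uf_basic S A\<close> form a base and are clopen for
  \<open>A \<subseteq> S\<close>.\<close>

definition uf_topology :: "'a set \<Rightarrow> 'a set set topology" where
  "uf_topology S =
     topology (\<lambda>\<U>. \<U> \<subseteq> ultrafilters_on S \<and> (\<forall>p\<in>\<U>. \<exists>A\<in>p. uf_basic S A \<subseteq> \<U>))"

lemma openin_uf_topology:
  "openin (uf_topology S) \<U> \<longleftrightarrow>
     \<U> \<subseteq> ultrafilters_on S \<and> (\<forall>p\<in>\<U>. \<exists>A\<in>p. uf_basic S A \<subseteq> \<U>)"
proof -
  have "istopology (\<lambda>\<U>. \<U> \<subseteq> ultrafilters_on S \<and> (\<forall>p\<in>\<U>. \<exists>A\<in>p. uf_basic S A \<subseteq> \<U>))"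
    (is "istopology ?P")
    unfolding istopology_def
  proof (intro conjI allI impI)
    fix \<U> \<V> assume U: "?P \<U>" and V: "?P \<V>"
    show "\<U> \<inter> \<V> \<subseteq> ultrafilters_on S" using U by (simp add: le_infI1)
    show "\<forall>p\<in>\<U> \<inter> \<V>. \<exists>A\<in>p. uf_basic S A \<subseteq> \<U> \<inter> \<V>"
    proof
      fix p assume p: "p \<in> \<U> \<inter> \<V>"
      then have pS: "p \<in> ultrafilters_on S" using U by (simp add: subset_iff)
      obtain A where A: "A \<in> p" "uf_basic S A \<subseteq> \<U>" using p U by (meson IntE)
      obtain B where B: "B \<in> p" "uf_basic S B \<subseteq> \<V>" using p V by (meson IntE)
      have "uf_basic S (A \<inter> B) \<subseteq> \<U> \<inter> \<V>"
        using Int_mono[OF A(2) B(2)] uf_basic_Int[OF uf_subset[OF pS A(1)] uf_subset[OF pS B(1)]]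
        by simp
      then show "\<exists>A\<in>p. uf_basic S A \<subseteq> \<U> \<inter> \<V>"
        using uf_Int[OF pS A(1) B(1)] by (rule bexI)
    qed
  next
    fix \<K> assume \<K>: "\<forall>U\<in>\<K>. ?P U"
    show "\<Union>\<K> \<subseteq> ultrafilters_on S" using \<K> by (simp add: Union_least)
    show "\<forall>p\<in>\<Union>\<K>. \<exists>A\<in>p. uf_basic S A \<subseteq> \<Union>\<K>"
    proof
      fix p assume "p \<in> \<Union>\<K>"
      then obtain U where U: "U \<in> \<K>" "p \<in> U" by (rule UnionE)
      then obtain A where "A \<in> p" "uf_basic S A \<subseteq> U" using \<K> by meson
      moreover have "U \<subseteq> \<Union>\<K>" using U(1) by (rule Union_upper)
      ultimately show "\<exists>A\<in>p. uf_basic S A \<subseteq> \<Union>\<K>" by (meson subset_trans)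
    qed
  qed
  then show ?thesis by (simp add: uf_topology_def topology_inverse')
qed

lemma openin_uf_basic: "openin (uf_topology S) (uf_basic S A)"
  unfolding openin_uf_topology
proof (intro conjI ballI)
  fix p assume "p \<in> uf_basic S A"
  then have "A \<in> p" by (simp add: uf_basic_def)
  then show "\<exists>B\<in>p. uf_basic S B \<subseteq> uf_basic S A" by (rule bexI[rotated]) simp
qed (rule uf_basic_subset)

lemma topspace_uf_topology [simp]: "topspace (uf_topology S) = ultrafilters_on S"
proof
  show "topspace (uf_topology S) \<subseteq> ultrafilters_on S"
    using openin_topspace[of "uf_topology S"] unfolding openin_uf_topology by simp
  have "uf_basic S S = ultrafilters_on S" using uf_top by (auto simp: uf_basic_def)
  then have "openin (uf_topology S) (ultrafilters_on S)" using openin_uf_basic[of S S] by simp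
  then show "ultrafilters_on S \<subseteq> topspace (uf_topology S)" by (rule openin_subset)
qed

lemma uf_basic_Diff:
  assumes "A \<subseteq> S"
  shows "uf_basic S (S - A) = ultrafilters_on S - uf_basic S A"
  using uf_Diff_iff[OF _ assms] by (auto simp: uf_basic_def)

lemma closedin_uf_basic:
  assumes "A \<subseteq> S"
  shows "closedin (uf_topology S) (uf_basic S A)"
  using openin_uf_basic[of S "S - A"] uf_basic_subset[of S A] uf_basic_Diff[OF assms]
  by (simp add: closedin_def)

lemma Hausdorff_uf_topology: "Hausdorff_space (uf_topology S)"
  unfolding Hausdorff_space_def
proof (intro allI impI, elim conjE)
  fix p q assume "p \<in> topspace (uf_topology S)" "q \<in> topspace (uf_topology S)" and ne: "p \<noteq> q"
  then have p: "p \<in> ultrafilters_on S" and q: "q \<in> ultrafilters_on S" by simp_all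
  obtain A where A: "A \<in> p" "A \<notin> q" using uf_eqI[OF p q] ne by (meson subsetI)
  have AS: "A \<subseteq> S" using uf_subset[OF p A(1)] .
  have "disjnt (uf_basic S A) (uf_basic S (S - A))"
    by (simp add: uf_basic_Diff[OF AS] disjnt_def)
  moreover have "p \<in> uf_basic S A" "q \<in> uf_basic S (S - A)"
    using p q A uf_Diff_iff[OF q AS] by (simp_all add: uf_basic_def)
  ultimately show "\<exists>U V. openin (uf_topology S) U \<and> openin (uf_topology S) V \<and>
      p \<in> U \<and> q \<in> V \<and> disjnt U V"
    using openin_uf_basic by meson
qed

text \<open>The cover is refined by basic sets. If no finitely many of the underlying subsets
  covered \<open>S\<close>, their complements would lie in a common ultrafilter, which no member of
  the cover could contain. Conversely, a finite union equal to \<open>S\<close> has a part in every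
  ultrafilter, which gives a finite subcover.\<close>

lemma compact_uf_topology: "compact_space (uf_topology S)"
  unfolding compact_space_alt
proof (intro allI impI, elim conjE)
  fix \<U> assume op: "\<forall>U\<in>\<U>. openin (uf_topology S) U" and cov: "topspace (uf_topology S) \<subseteq> \<Union>\<U>"
  define \<A> where "\<A> = {A. A \<subseteq> S \<and> (\<exists>U\<in>\<U>. uf_basic S A \<subseteq> U)}"
  have "\<exists>\<G>. finite \<G> \<and> \<G> \<subseteq> (\<lambda>A. S - A) ` \<A> \<and> S \<inter> \<Inter>\<G> = {}"
  proof (rule ccontr)
    assume "\<nexists>\<G>. finite \<G> \<and> \<G> \<subseteq> (\<lambda>A. S - A) ` \<A> \<and> S \<inter> \<Inter>\<G> = {}"
    then have ne: "S \<inter> \<Inter>\<G> \<noteq> {}" if "finite \<G>" "\<G> \<subseteq> (\<lambda>A. S - A) ` \<A>" for \<G>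
      using that by iprover
    have "(\<lambda>A. S - A) ` \<A> \<subseteq> Pow S" by auto
    from ultrafilter_exists_fip[OF this ne]
    obtain p where p: "p \<in> ultrafilters_on S" and sub: "(\<lambda>A. S - A) ` \<A> \<subseteq> p" by (rule bexE)
    obtain U where U: "U \<in> \<U>" "p \<in> U" using cov p by auto
    then obtain A where A: "A \<in> p" "uf_basic S A \<subseteq> U"
      using op unfolding openin_uf_topology by meson
    have AS: "A \<subseteq> S" using uf_subset[OF p A(1)] .
    then have "A \<in> \<A>" using A(2) U(1) by (auto simp: \<A>_def)
    then have "S - A \<in> p" using sub by (simp add: image_subset_iff)
    then show False using uf_Diff_iff[OF p AS] A(1) by simp
  qed
  then obtain \<G> where "finite \<G>" "\<G> \<subseteq> (\<lambda>A. S - A) ` \<A>" and empty: "S \<inter> \<Inter>\<G> = {}"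
    by (elim exE conjE)
  then obtain \<H> where \<H>: "\<H> \<subseteq> \<A>" "finite \<H>" "\<G> = (\<lambda>A. S - A) ` \<H>"
    using finite_subset_image by metis
  have HS: "A \<subseteq> S" if "A \<in> \<H>" for A using \<H>(1) that by (auto simp: \<A>_def)
  have "S \<subseteq> \<Union>\<H>" using empty unfolding \<H>(3) by auto
  then have UH: "\<Union>\<H> = S" using HS by (simp add: Union_least subset_antisym)
  have "\<exists>U. U \<in> \<U> \<and> uf_basic S A \<subseteq> U" if "A \<in> \<H>" for A
    using that \<H>(1) by (auto simp: \<A>_def)
  then obtain u where u: "\<And>A. A \<in> \<H> \<Longrightarrow> u A \<in> \<U> \<and> uf_basic S A \<subseteq> u A"
    by metis
  have "ultrafilters_on S \<subseteq> \<Union>(u ` \<H>)"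
  proof
    fix p assume p: "p \<in> ultrafilters_on S"
    then obtain A where A: "A \<in> \<H>" "A \<in> p"
      using uf_UN[OF p \<H>(2), of "\<lambda>A. A"] uf_top[OF p] HS UH by auto
    then have "p \<in> u A" using u[OF A(1)] uf_basicI[OF p A(2)] by (simp add: subset_iff)
    then show "p \<in> \<Union>(u ` \<H>)" using A(1) by (rule UN_I[rotated])
  qed
  moreover have "u ` \<H> \<subseteq> \<U>" using u by (simp add: image_subset_iff)
  ultimately show "\<exists>\<F>. finite \<F> \<and> \<F> \<subseteq> \<U> \<and> topspace (uf_topology S) \<subseteq> \<Union>\<F>"
    using \<H>(2) by (intro exI[of _ "u ` \<H>"]) simp
qed

section \<open>Images of ultrafilters under maps and binary operations\<close>

definition uf_map :: "'a set \<Rightarrow> 'b set \<Rightarrow> ('a \<Rightarrow> 'b) \<Rightarrow> 'a set set \<Rightarrow> 'b set set" where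
  "uf_map X Z h p = {A. A \<subseteq> Z \<and> {x \<in> X. h x \<in> A} \<in> p}"

text \<open>The image under \<open>h\<close> of the tensor product of \<open>p\<close> and
  \<open>q\<close>. Three separate carriers allow the same construction to express both addition and
  the action of \<open>S\<close> on \<open>S \<times> S\<close>.\<close>

definition uf_prod ::
  "'a set \<Rightarrow> 'b set \<Rightarrow> 'c set \<Rightarrow> ('a \<Rightarrow> 'b \<Rightarrow> 'c) \<Rightarrow> 'a set set \<Rightarrow> 'b set set \<Rightarrow> 'c set set" where
  "uf_prod X Y Z h p q = {A. A \<subseteq> Z \<and> {x \<in> X. {y \<in> Y. h x y \<in> A} \<in> q} \<in> p}"

lemma uf_add_eq_uf_prod: "uf_add S = uf_prod S S S (+)"
  by (simp add: fun_eq_iff uf_add_def uf_prod_def translate_def)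

lemma uf_map_id: "p \<in> ultrafilters_on S \<Longrightarrow> uf_map S S (\<lambda>x. x) p = p"
proof -
  assume p: "p \<in> ultrafilters_on S"
  have "{x \<in> S. x \<in> A} = A" if "A \<subseteq> S" for A using that by blast
  then show "uf_map S S (\<lambda>x. x) p = p"
    using uf_subset[OF p] by (auto simp: uf_map_def)
qed

lemma ultrafilter_uf_map:
  assumes p: "p \<in> ultrafilters_on X" and h: "\<And>x. x \<in> X \<Longrightarrow> h x \<in> Z"
  shows "uf_map X Z h p \<in> ultrafilters_on Z"
proof (rule ultrafilters_onI)
  show "uf_map X Z h p \<subseteq> Pow Z" by (auto simp: uf_map_def)
  have "{x \<in> X. h x \<in> Z} = X" using h by blast
  then show "Z \<in> uf_map X Z h p" using uf_top[OF p] by (simp add: uf_map_def)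
next
  fix A B assume "A \<subseteq> Z" "B \<subseteq> Z"
  moreover have "{x \<in> X. h x \<in> A \<inter> B} = {x \<in> X. h x \<in> A} \<inter> {x \<in> X. h x \<in> B}" by blast
  ultimately show "A \<inter> B \<in> uf_map X Z h p \<longleftrightarrow> A \<in> uf_map X Z h p \<and> B \<in> uf_map X Z h p"
    by (auto simp: uf_map_def uf_Int_iff[OF p])
next
  fix A assume "A \<subseteq> Z"
  moreover have "{x \<in> X. h x \<in> Z - A} = X - {x \<in> X. h x \<in> A}" using h by blast
  ultimately show "Z - A \<in> uf_map X Z h p \<longleftrightarrow> A \<notin> uf_map X Z h p"
    by (auto simp: uf_map_def uf_Diff_iff[OF p])
qed

lemma ultrafilter_uf_prod:
  assumes p: "p \<in> ultrafilters_on X" and q: "q \<in> ultrafilters_on Y"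
    and h: "\<And>x y. \<lbrakk>x \<in> X; y \<in> Y\<rbrakk> \<Longrightarrow> h x y \<in> Z"
  shows "uf_prod X Y Z h p q \<in> ultrafilters_on Z"
proof (rule ultrafilters_onI)
  \<comment> \<open>For fixed \<open>x\<close> the inner condition says that \<open>A\<close> lies
    in the image of \<open>q\<close> under \<open>h x\<close>, which is an ultrafilter.
    Intersections and complements therefore pass first through \<open>q\<close> and then through
    \<open>p\<close>.\<close>
  have mem: "{y \<in> Y. h x y \<in> A} \<in> q \<longleftrightarrow> A \<in> uf_map Y Z (h x) q" if "A \<subseteq> Z" for x A
    using that by (simp add: uf_map_def)
  have u: "uf_map Y Z (h x) q \<in> ultrafilters_on Z" if "x \<in> X" for x
    using ultrafilter_uf_map[OF q] h that by blast
  show "uf_prod X Y Z h p q \<subseteq> Pow Z" by (auto simp: uf_prod_def)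
  have "{x \<in> X. {y \<in> Y. h x y \<in> Z} \<in> q} = X" using mem uf_top[OF u] by auto
  then show "Z \<in> uf_prod X Y Z h p q" using uf_top[OF p] by (simp add: uf_prod_def)
  show "A \<inter> B \<in> uf_prod X Y Z h p q \<longleftrightarrow> A \<in> uf_prod X Y Z h p q \<and> B \<in> uf_prod X Y Z h p q"
    if AB: "A \<subseteq> Z" "B \<subseteq> Z" for A B
  proof -
    have "A \<inter> B \<subseteq> Z" using AB by blast
    have "{x \<in> X. {y \<in> Y. h x y \<in> A \<inter> B} \<in> q}
        = {x \<in> X. {y \<in> Y. h x y \<in> A} \<in> q} \<inter> {x \<in> X. {y \<in> Y. h x y \<in> B} \<in> q}"
      unfolding mem[OF AB(1)] mem[OF AB(2)] mem[OF \<open>A \<inter> B \<subseteq> Z\<close>] using uf_Int_iff[OF u AB] by blast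
    then show ?thesis
      using AB \<open>A \<inter> B \<subseteq> Z\<close>
        uf_Int_iff[OF p, of "{x \<in> X. {y \<in> Y. h x y \<in> A} \<in> q}"
          "{x \<in> X. {y \<in> Y. h x y \<in> B} \<in> q}"]
      by (simp add: uf_prod_def)
  qed
  show "Z - A \<in> uf_prod X Y Z h p q \<longleftrightarrow> A \<notin> uf_prod X Y Z h p q" if A: "A \<subseteq> Z" for A
  proof -
    have "{x \<in> X. {y \<in> Y. h x y \<in> Z - A} \<in> q} = X - {x \<in> X. {y \<in> Y. h x y \<in> A} \<in> q}"
      unfolding mem[OF A] mem[OF Diff_subset] using uf_Diff_iff[OF u A] by blast
    then show ?thesis
      using A uf_Diff_iff[OF p, of "{x \<in> X. {y \<in> Y. h x y \<in> A} \<in> q}"]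
      by (simp add: uf_prod_def)
  qed
qed

text \<open>
  The carriers and operations may all differ, so this also covers the mixed associative laws between
  the addition on \<open>S \<times> S\<close> and the action of \<open>S\<close> on it.
\<close>

lemma uf_prod_assoc:
  assumes "\<And>x y. \<lbrakk>x \<in> X; y \<in> Y\<rbrakk> \<Longrightarrow> h2 x y \<in> M" "\<And>y z. \<lbrakk>y \<in> Y; z \<in> Z\<rbrakk> \<Longrightarrow> h4 y z \<in> N"
    and assoc: "\<And>x y z. \<lbrakk>x \<in> X; y \<in> Y; z \<in> Z\<rbrakk> \<Longrightarrow> h1 (h2 x y) z = h3 x (h4 y z)"
  shows "uf_prod M Z V h1 (uf_prod X Y M h2 p q) r = uf_prod X N V h3 p (uf_prod Y Z N h4 q r)"
proof -
  have "{x \<in> X. {y \<in> Y. h2 x y \<in> {a \<in> M. {z \<in> Z. h1 a z \<in> A} \<in> r}} \<in> q} =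
        {x \<in> X. {y \<in> Y. {z \<in> Z. h4 y z \<in> {b \<in> N. h3 x b \<in> A}} \<in> r} \<in> q}" for A
  proof (rule Collect_cong, rule conj_cong[OF refl])
    fix x assume x: "x \<in> X"
    have "{z \<in> Z. h1 (h2 x y) z \<in> A} = {z \<in> Z. h4 y z \<in> {b \<in> N. h3 x b \<in> A}}" if "y \<in> Y" for y
      using assms x that by auto
    then have "{y \<in> Y. h2 x y \<in> {a \<in> M. {z \<in> Z. h1 a z \<in> A} \<in> r}} =
        {y \<in> Y. {z \<in> Z. h4 y z \<in> {b \<in> N. h3 x b \<in> A}} \<in> r}"
      using assms(1) x by auto
    then show "({y \<in> Y. h2 x y \<in> {a \<in> M. {z \<in> Z. h1 a z \<in> A} \<in> r}} \<in> q) =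
      ({y \<in> Y. {z \<in> Z. h4 y z \<in> {b \<in> N. h3 x b \<in> A}} \<in> r} \<in> q)" by simp
  qed
  then show ?thesis by (auto simp: uf_prod_def)
qed

text \<open>A pointwise identity between maps on elements lifts to ultrafilters. The homomorphism
  law of \<open>push\<close> and its compatibility with both actions are instances.\<close>

lemma uf_map_uf_prod:
  assumes h: "\<And>x y. \<lbrakk>x \<in> X; y \<in> Y\<rbrakk> \<Longrightarrow> h x y \<in> Z"
    and f1: "\<And>x. x \<in> X \<Longrightarrow> f1 x \<in> X'" and f2: "\<And>y. y \<in> Y \<Longrightarrow> f2 y \<in> Y'"
    and eq: "\<And>x y. \<lbrakk>x \<in> X; y \<in> Y\<rbrakk> \<Longrightarrow> f (h x y) = h' (f1 x) (f2 y)"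
  shows "uf_map Z Z' f (uf_prod X Y Z h p q) =
    uf_prod X' Y' Z' h' (uf_map X X' f1 p) (uf_map Y Y' f2 q)"
proof -
  have *: "{x \<in> X. {y \<in> Y. h x y \<in> {z \<in> Z. f z \<in> A}} \<in> q} =
        {x \<in> X. f1 x \<in> {x' \<in> X'. {y \<in> Y. f2 y \<in> {y' \<in> Y'. h' x' y' \<in> A}} \<in> q}}" for A
  proof (rule Collect_cong, rule conj_cong[OF refl])
    fix x assume x: "x \<in> X"
    have "{y \<in> Y. h x y \<in> {z \<in> Z. f z \<in> A}} = {y \<in> Y. f2 y \<in> {y' \<in> Y'. h' (f1 x) y' \<in> A}}"
      using assms x by auto
    then show "({y \<in> Y. h x y \<in> {z \<in> Z. f z \<in> A}} \<in> q) =
      (f1 x \<in> {x' \<in> X'. {y \<in> Y. f2 y \<in> {y' \<in> Y'. h' x' y' \<in> A}} \<in> q})"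
      using f1 x by simp
  qed
  show ?thesis
    by (auto simp: uf_map_def uf_prod_def *[unfolded mem_Collect_eq])
qed

lemma continuous_map_into_uf_topology:
  assumes F: "\<And>x. x \<in> topspace X \<Longrightarrow> F x \<in> ultrafilters_on Z"
    and op: "\<And>A. A \<subseteq> Z \<Longrightarrow> openin X {x \<in> topspace X. A \<in> F x}"
  shows "continuous_map X (uf_topology Z) F"
  unfolding continuous_map_def
proof (intro conjI allI impI funcsetI)
  show "F x \<in> topspace (uf_topology Z)" if "x \<in> topspace X" for x
    using F[OF that] by simp
  fix U assume U: "openin (uf_topology Z) U"
  show "openin X {x \<in> topspace X. F x \<in> U}"
  proof (subst openin_subopen, intro ballI)
    fix x assume "x \<in> {x \<in> topspace X. F x \<in> U}"
    then have x: "x \<in> topspace X" "F x \<in> U" by simp_all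
    obtain A where A: "A \<in> F x" "uf_basic Z A \<subseteq> U"
      using U x(2) unfolding openin_uf_topology by blast
    let ?V = "{x \<in> topspace X. A \<in> F x}"
    have "openin X ?V" using op uf_subset[OF F[OF x(1)] A(1)] .
    moreover have "x \<in> ?V" using x A by simp
    moreover have "?V \<subseteq> {x \<in> topspace X. F x \<in> U}"
    proof
      fix y assume "y \<in> ?V"
      then have "F y \<in> uf_basic Z A" "y \<in> topspace X" using F by (simp_all add: uf_basic_def)
      then show "y \<in> {x \<in> topspace X. F x \<in> U}" using A(2) by (simp add: subset_iff)
    qed
    ultimately show "\<exists>V. openin X V \<and> x \<in> V \<and> V \<subseteq> {x \<in> topspace X. F x \<in> U}"
      by (intro exI[of _ ?V] conjI)
  qed
qed

text \<open>With \<open>q\<close> fixed, \<open>A\<close> belongs to the product exactly when one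
  fixed subset of \<open>X\<close> belongs to \<open>p\<close>; so the preimage of a basic open set
  is again basic. This is the right topological property.\<close>

lemma continuous_map_uf_prod:
  assumes q: "q \<in> ultrafilters_on Y" and h: "\<And>x y. \<lbrakk>x \<in> X; y \<in> Y\<rbrakk> \<Longrightarrow> h x y \<in> Z"
  shows "continuous_map (uf_topology X) (uf_topology Z) (\<lambda>p. uf_prod X Y Z h p q)"
proof (rule continuous_map_into_uf_topology)
  show "uf_prod X Y Z h p q \<in> ultrafilters_on Z" if "p \<in> topspace (uf_topology X)" for p
    using ultrafilter_uf_prod[OF _ q h] that by simp
  show "openin (uf_topology X) {p \<in> topspace (uf_topology X). A \<in> uf_prod X Y Z h p q}"
    if "A \<subseteq> Z" for A
    using openin_uf_basic[of X "{x \<in> X. {y \<in> Y. h x y \<in> A} \<in> q}"] that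
    by (simp add: uf_prod_def uf_basic_def)
qed

lemma continuous_map_uf_map:
  assumes h: "\<And>x. x \<in> X \<Longrightarrow> h x \<in> Z"
  shows "continuous_map (uf_topology X) (uf_topology Z) (uf_map X Z h)"
proof (rule continuous_map_into_uf_topology)
  show "uf_map X Z h p \<in> ultrafilters_on Z" if "p \<in> topspace (uf_topology X)" for p
    using ultrafilter_uf_map[OF _ h] that by simp
  show "openin (uf_topology X) {p \<in> topspace (uf_topology X). A \<in> uf_map X Z h p}"
    if "A \<subseteq> Z" for A
    using openin_uf_basic[of X "{x \<in> X. h x \<in> A}"] that
    by (simp add: uf_map_def uf_basic_def)
qed

section \<open>Ultrafilters near zero\<close>

lemma nbhds0_iff:
  assumes "0 \<in> T"
  shows "U \<in> nbhds0 T \<longleftrightarrow> U \<subseteq> T \<and> (\<exists>G. open G \<and> 0 \<in> G \<and> T \<inter> G \<subseteq> U)"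
  using assms unfolding nbhds0_def openin_open by auto

lemma nbhds0_self: "0 \<in> T \<Longrightarrow> T \<in> nbhds0 T"
  by (auto simp: nbhds0_iff)

lemma nbhds0_Int:
  assumes "0 \<in> T" "U \<in> nbhds0 T" "V \<in> nbhds0 T"
  shows "U \<inter> V \<in> nbhds0 T"
proof -
  obtain G H where "open G" "0 \<in> G" "T \<inter> G \<subseteq> U" "open H" "0 \<in> H" "T \<inter> H \<subseteq> V" "U \<subseteq> T"
    using assms by (auto simp: nbhds0_iff)
  then show ?thesis
    using assms(1) by (auto simp: nbhds0_iff intro!: exI[of _ "G \<inter> H"])
qed

lemma nbhds0_vimage:
  assumes "0 \<in> T" "0 \<in> T'" "h 0 = 0" "continuous_on UNIV h" "\<And>x. x \<in> T \<Longrightarrow> h x \<in> T'"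
    and U: "U \<in> nbhds0 T'"
  shows "{x \<in> T. h x \<in> U} \<in> nbhds0 T"
proof -
  obtain G where G: "open G" "0 \<in> G" "T' \<inter> G \<subseteq> U"
    using U assms(2) by (auto simp: nbhds0_iff)
  have "open (h -` G)" using G(1) assms(4) by (simp add: open_vimage)
  then show ?thesis
    using assms(1,3,5) G by (auto simp: nbhds0_iff intro!: exI[of _ "h -` G"])
qed

lemma nbhds0_vimage2:
  assumes "0 \<in> T1" "0 \<in> T2" "0 \<in> T" "h 0 0 = 0"
    and cont: "continuous_on UNIV (\<lambda>z. h (fst z) (snd z))"
    and "\<And>x y. \<lbrakk>x \<in> T1; y \<in> T2\<rbrakk> \<Longrightarrow> h x y \<in> T"
    and U: "U \<in> nbhds0 T"
  obtains V W where "V \<in> nbhds0 T1" "W \<in> nbhds0 T2" "\<And>x y. \<lbrakk>x \<in> V; y \<in> W\<rbrakk> \<Longrightarrow> h x y \<in> U"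
proof -
  obtain G where G: "open G" "0 \<in> G" "T \<inter> G \<subseteq> U"
    using U assms(3) by (auto simp: nbhds0_iff)
  have "open ((\<lambda>z. h (fst z) (snd z)) -` G)" using G(1) cont by (simp add: open_vimage)
  moreover have "(0, 0) \<in> (\<lambda>z. h (fst z) (snd z)) -` G" using G(2) assms(4) by simp
  ultimately obtain A B where AB: "open A" "open B" "0 \<in> A" "0 \<in> B"
    and sub: "A \<times> B \<subseteq> (\<lambda>z. h (fst z) (snd z)) -` G"
    by (rule open_prod_elim) auto
  show ?thesis
  proof
    show "T1 \<inter> A \<in> nbhds0 T1" "T2 \<inter> B \<in> nbhds0 T2"
      using AB assms(1,2) by (auto simp: nbhds0_iff)
    fix x y assume "x \<in> T1 \<inter> A" "y \<in> T2 \<inter> B"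
    then show "h x y \<in> U" using sub assms(6) G(3) by fastforce
  qed
qed

lemma ufs_near0_subset: "p \<in> ufs_near0 T S \<Longrightarrow> p \<in> ultrafilters_on S"
  and ufs_near0_nbhds0: "\<lbrakk>p \<in> ufs_near0 T S; U \<in> nbhds0 T\<rbrakk> \<Longrightarrow> U \<inter> S \<in> p"
  by (simp_all add: ufs_near0_def)

lemma uf_map_near0:
  assumes p: "p \<in> ufs_near0 T S" and h: "\<And>x. x \<in> S \<Longrightarrow> h x \<in> S'"
    and "0 \<in> T" "0 \<in> T'" "h 0 = 0" "continuous_on UNIV h" "\<And>x. x \<in> T \<Longrightarrow> h x \<in> T'"
  shows "uf_map S S' h p \<in> ufs_near0 T' S'"
proof -
  have "U \<inter> S' \<in> uf_map S S' h p" if "U \<in> nbhds0 T'" for U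
  proof -
    have "{x \<in> T. h x \<in> U} \<inter> S \<in> p"
      using ufs_near0_nbhds0[OF p] nbhds0_vimage[OF assms(3-7) that] by simp
    then have "{x \<in> S. h x \<in> U \<inter> S'} \<in> p"
      by (rule uf_mono[OF ufs_near0_subset[OF p]]) (use h in auto)
    then show ?thesis by (simp add: uf_map_def)
  qed
  then show ?thesis
    using ultrafilter_uf_map[OF ufs_near0_subset[OF p] h] by (simp add: ufs_near0_def)
qed

text \<open>Continuity of \<open>h\<close> at the origin supplies neighborhoods \<open>V\<close> and
  \<open>W\<close> with \<open>h\<close> mapping \<open>V \<times> W\<close> into \<open>U\<close>.
  This serves the addition and both actions.\<close>

lemma uf_prod_near0:
  assumes p: "p \<in> ufs_near0 T1 S1" and q: "q \<in> ufs_near0 T2 S2"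
    and h: "\<And>x y. \<lbrakk>x \<in> S1; y \<in> S2\<rbrakk> \<Longrightarrow> h x y \<in> S"
    and T: "0 \<in> T1" "0 \<in> T2" "0 \<in> T" "h 0 0 = 0"
      "continuous_on UNIV (\<lambda>z. h (fst z) (snd z))" "\<And>x y. \<lbrakk>x \<in> T1; y \<in> T2\<rbrakk> \<Longrightarrow> h x y \<in> T"
  shows "uf_prod S1 S2 S h p q \<in> ufs_near0 T S"
proof -
  note pu = ufs_near0_subset[OF p] and qu = ufs_near0_subset[OF q]
  have "U \<inter> S \<in> uf_prod S1 S2 S h p q" if U: "U \<in> nbhds0 T" for U
  proof -
    obtain V W where V: "V \<in> nbhds0 T1" and W: "W \<in> nbhds0 T2"
      and VW: "\<And>x y. \<lbrakk>x \<in> V; y \<in> W\<rbrakk> \<Longrightarrow> h x y \<in> U"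
      using nbhds0_vimage2[OF T U] by blast
    have "{y \<in> S2. h x y \<in> U \<inter> S} \<in> q" if x: "x \<in> V \<inter> S1" for x
      using ufs_near0_nbhds0[OF q W]
      by (rule uf_mono[OF qu]) (use h x VW in auto)
    then have "V \<inter> S1 \<subseteq> {x \<in> S1. {y \<in> S2. h x y \<in> U \<inter> S} \<in> q}"
      by (intro subsetI CollectI conjI) blast+
    then have "{x \<in> S1. {y \<in> S2. h x y \<in> U \<inter> S} \<in> q} \<in> p"
      by (rule uf_mono[OF pu ufs_near0_nbhds0[OF p V]]) simp
    then show ?thesis by (simp add: uf_prod_def)
  qed
  then show ?thesis
    using ultrafilter_uf_prod[OF pu qu h] by (simp add: ufs_near0_def)
qed

lemma decreasing_base0_exists:
  fixes T :: "'a::{first_countable_topology, zero} set"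
  assumes "0 \<in> T"
  obtains W where "decreasing_base0 T W"
proof -
  obtain A :: "nat \<Rightarrow> 'a set" where A: "\<And>i. open (A i)" "\<And>i. 0 \<in> A i"
    and ev: "\<And>G. open G \<Longrightarrow> 0 \<in> G \<Longrightarrow> eventually (\<lambda>i. A i \<subseteq> G) sequentially"
    using countable_basis_at_decseq[of 0] by metis
  define W where "W n = T \<inter> (\<Inter>i\<le>n. A i)" for n
  have "W n \<in> nbhds0 T" for n
    using assms A by (auto simp: W_def nbhds0_iff intro!: exI[of _ "\<Inter>i\<le>n. A i"])
  moreover have "decseq W"
    by (auto simp: decseq_def W_def)
  moreover have "\<exists>n. W n \<subseteq> U" if U: "U \<in> nbhds0 T" for U
  proof -
    obtain G where G: "open G" "0 \<in> G" "T \<inter> G \<subseteq> U"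
      using U assms by (auto simp: nbhds0_iff)
    obtain n where "A n \<subseteq> G" using ev[OF G(1,2)] by (auto simp: eventually_sequentially)
    then have "W n \<subseteq> U" using G(3) by (auto simp: W_def)
    then show ?thesis ..
  qed
  ultimately have "decreasing_base0 T W" by (simp add: decreasing_base0_def)
  then show ?thesis by (rule that)
qed

section \<open>The compact semigroup of ultrafilters near zero\<close>

definition near0_topology ::
  "'a::{topological_space, zero} set \<Rightarrow> 'a set \<Rightarrow> 'a set set topology" where
  "near0_topology T S = subtopology (uf_topology S) (ufs_near0 T S)"

lemma topspace_near0_topology [simp]: "topspace (near0_topology T S) = ufs_near0 T S"
  by (auto simp: near0_topology_def ufs_near0_def)

lemma closedin_near0_basic:
  assumes "A \<subseteq> S"
  shows "closedin (near0_topology T S) {p \<in> ufs_near0 T S. A \<in> p}"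
proof -
  have "{p \<in> ufs_near0 T S. A \<in> p} = uf_basic S A \<inter> ufs_near0 T S"
    by (auto simp: uf_basic_def ufs_near0_def)
  then show ?thesis
    using closedin_uf_basic[OF assms] by (auto simp: near0_topology_def closedin_subtopology)
qed

text \<open>Common setting for \<open>S\<close> in the half-line and \<open>S \<times> S\<close> in
  the quadrant. First countability provides a decreasing base, and the T1 axiom allows a single
  nonzero point to be removed from a neighborhood of zero.\<close>

locale near_zero_semigroup =
  fixes T S :: "'a::{first_countable_topology, t1_space, topological_comm_monoid_add} set"
  assumes zero_T: "0 \<in> T" and add_T: "\<lbrakk>x \<in> T; y \<in> T\<rbrakk> \<Longrightarrow> x + y \<in> T"
    and S_subset: "S \<subseteq> T" and add_S: "\<lbrakk>x \<in> S; y \<in> S\<rbrakk> \<Longrightarrow> x + y \<in> S"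
    and zero_notin: "0 \<notin> S" and zero_closure: "0 \<in> closure S"
begin

lemma nbhds0_meets: "U \<in> nbhds0 T \<Longrightarrow> U \<inter> S \<noteq> {}"
  using zero_closure S_subset by (fastforce simp: nbhds0_iff[OF zero_T] closure_iff_nhds_not_empty)

text \<open>The traces of the neighborhoods of zero on \<open>D\<close> form a filter base, and any
  ultrafilter extending it contains \<open>D\<close> and is near zero.\<close>

lemma uf_near0_exists:
  assumes D: "D \<subseteq> S" "\<And>U. U \<in> nbhds0 T \<Longrightarrow> U \<inter> D \<noteq> {}"
  obtains p where "p \<in> ufs_near0 T S" "D \<in> p"
proof -
  have "\<exists>p\<in>ultrafilters_on S. (\<lambda>U. U \<inter> D) ` nbhds0 T \<subseteq> p"
  proof (rule ultrafilter_exists_filter_base)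
    show "(\<lambda>U. U \<inter> D) ` nbhds0 T \<subseteq> Pow S" using D(1) by auto
    show "(\<lambda>U. U \<inter> D) ` nbhds0 T \<noteq> {}" using nbhds0_self[OF zero_T] by auto
    show "{} \<notin> (\<lambda>U. U \<inter> D) ` nbhds0 T" using D(2) by auto
    fix A B assume "A \<in> (\<lambda>U. U \<inter> D) ` nbhds0 T" "B \<in> (\<lambda>U. U \<inter> D) ` nbhds0 T"
    then obtain U V where UV: "U \<in> nbhds0 T" "A = U \<inter> D" "V \<in> nbhds0 T" "B = V \<inter> D"
      by (elim imageE)
    have "(U \<inter> V) \<inter> D \<in> (\<lambda>U. U \<inter> D) ` nbhds0 T"
      using nbhds0_Int[OF zero_T UV(1,3)] by (rule imageI)
    moreover have "(U \<inter> V) \<inter> D \<subseteq> A \<inter> B" unfolding UV by auto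
    ultimately show "\<exists>C\<in>(\<lambda>U. U \<inter> D) ` nbhds0 T. C \<subseteq> A \<inter> B" by (rule bexI[rotated])
  qed
  then obtain p where p: "p \<in> ultrafilters_on S" "(\<lambda>U. U \<inter> D) ` nbhds0 T \<subseteq> p" by (rule bexE)
  have UD: "U \<inter> D \<in> p" if "U \<in> nbhds0 T" for U
    using p(2) that by (simp add: image_subset_iff)
  have "U \<inter> S \<in> p" if "U \<in> nbhds0 T" for U
    by (rule uf_mono[OF p(1) UD[OF that]]) (use D(1) in auto)
  moreover have "D \<in> p"
    by (rule uf_mono[OF p(1) UD[OF nbhds0_self[OF zero_T]]]) (use D(1) in auto)
  ultimately show ?thesis using p(1) that[of p] by (simp add: ufs_near0_def)
qed

lemma uf_add_near0: "\<lbrakk>p \<in> ufs_near0 T S; q \<in> ufs_near0 T S\<rbrakk> \<Longrightarrow> uf_add S p q \<in> ufs_near0 T S"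
  unfolding uf_add_eq_uf_prod
  by (rule uf_prod_near0) (auto simp: zero_T add_T add_S intro!: continuous_intros)

lemma closedin_ufs_near0: "closedin (uf_topology S) (ufs_near0 T S)"
proof -
  have "ufs_near0 T S = (\<Inter>U\<in>nbhds0 T. uf_basic S (U \<inter> S))"
    using nbhds0_self[OF zero_T] by (auto simp: ufs_near0_def uf_basic_def)
  moreover have "closedin (uf_topology S) (\<Inter>U\<in>nbhds0 T. uf_basic S (U \<inter> S))"
    using nbhds0_self[OF zero_T] by (intro closedin_INT closedin_uf_basic) auto
  ultimately show ?thesis by simp
qed

sublocale compact_right_topological_semigroup "near0_topology T S" "uf_add S"
proof
  show "compact_space (near0_topology T S)"
    unfolding near0_topology_def
    by (rule compact_space_subtopology
        [OF closedin_compact_space[OF compact_uf_topology closedin_ufs_near0]])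
  show "Hausdorff_space (near0_topology T S)"
    unfolding near0_topology_def by (rule Hausdorff_space_subtopology[OF Hausdorff_uf_topology])
  obtain p where "p \<in> ufs_near0 T S" using uf_near0_exists[of S] nbhds0_meets by blast
  then show "topspace (near0_topology T S) \<noteq> {}" by auto
next
  fix p q assume "p \<in> topspace (near0_topology T S)" "q \<in> topspace (near0_topology T S)"
  then show "uf_add S p q \<in> topspace (near0_topology T S)" using uf_add_near0 by simp
next
  fix p q r
  show "uf_add S (uf_add S p q) r = uf_add S p (uf_add S q r)"
    unfolding uf_add_eq_uf_prod by (rule uf_prod_assoc) (auto simp: add_S add.assoc)
next
  fix q assume "q \<in> topspace (near0_topology T S)"
  then have q: "q \<in> ufs_near0 T S" by simp
  have "continuous_map (uf_topology S) (uf_topology S) (\<lambda>p. uf_add S p q)"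
    unfolding uf_add_eq_uf_prod
    by (rule continuous_map_uf_prod[OF ufs_near0_subset[OF q]]) (rule add_S)
  then show "continuous_map (near0_topology T S) (near0_topology T S) (\<lambda>p. uf_add S p q)"
    unfolding near0_topology_def
    using uf_add_near0[OF _ q]
    by (simp add: continuous_map_in_subtopology continuous_map_from_subtopology image_subset_iff
          Pi_iff)
qed

end

section \<open>Piecewise syndetic and IP sets near zero\<close>

context near_zero_semigroup
begin

section \<open>Piecewise syndetic sets and the smallest ideal\<close>

lemma mem_uf_add_iff:
  assumes "A \<subseteq> S"
  shows "A \<in> uf_add S p q \<longleftrightarrow> {s \<in> S. translate S s A \<in> q} \<in> p"
  using assms by (simp add: uf_add_def)

lemma translate_subset: "translate S s A \<subseteq> S"
  by (auto simp: translate_def)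

lemma translate_translate:
  "g \<in> S \<Longrightarrow> translate S g (translate S t A) = {x \<in> S. t + (g + x) \<in> A}"
  by (auto simp: translate_def add_S)

lemma smallest_ideal_add_left: "\<lbrakk>q \<in> ufs_near0 T S; p \<in> smallest_ideal (uf_add S) (ufs_near0 T S)\<rbrakk>
    \<Longrightarrow> uf_add S q p \<in> smallest_ideal (uf_add S) (ufs_near0 T S)"
  and smallest_ideal_add_right: "\<lbrakk>q \<in> ufs_near0 T S; p \<in> smallest_ideal (uf_add S) (ufs_near0 T S)\<rbrakk>
    \<Longrightarrow> uf_add S p q \<in> smallest_ideal (uf_add S) (ufs_near0 T S)"
  using two_sided_ideal_smallest_ideal by (simp_all add: two_sided_ideal_def)

lemma smallest_ideal_near0: "smallest_ideal (uf_add S) (ufs_near0 T S) \<subseteq> ufs_near0 T S"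
  using smallest_ideal_subset by simp

text \<open>Return times to a member of a minimal \<open>p\<close> are syndetic near zero. Otherwise
  some \<open>q\<close> near zero would avoid all the sets \<open>D t\<close> with \<open>t\<close>
  in \<open>W \<inter> S\<close>, whereas minimality recovers \<open>p\<close> as
  \<open>r + (q + p)\<close>, and \<open>A \<in> p\<close> then yields such a \<open>t\<close> with
  \<open>D t \<in> q\<close>.\<close>

lemma return_times_near0:
  assumes p: "p \<in> smallest_ideal (uf_add S) (ufs_near0 T S)" and A: "A \<in> p"
    and W: "W \<in> nbhds0 T"
  obtains F V where "finite F" "F \<noteq> {}" "F \<subseteq> W \<inter> S" "V \<in> nbhds0 T" "V \<subseteq> W"
    "\<And>g. g \<in> V \<inter> S \<Longrightarrow> \<exists>t\<in>F. {x \<in> S. t + (g + x) \<in> A} \<in> p"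
proof -
  obtain L where L: "minimal_left_ideal L" "p \<in> L"
    using p smallest_ideal_eq by auto
  have pE: "p \<in> ufs_near0 T S" using p smallest_ideal_near0 by blast
  have AS: "A \<subseteq> S" using uf_subset[OF ufs_near0_subset[OF pE] A] .
  \<comment> \<open>Chosen so that \<open>D t \<in> q\<close> means
    \<open>-t + A \<in> q + p\<close>.\<close>
  define D where "D t = {g \<in> S. {x \<in> S. t + (g + x) \<in> A} \<in> p}" for t
  define base where "base = {U \<inter> S - \<Union>(D ` F) |U F. U \<in> nbhds0 T \<and> finite F \<and> F \<subseteq> W \<inter> S}"
  have base_memI: "U \<inter> S - \<Union>(D ` F) \<in> base" if "U \<in> nbhds0 T" "finite F" "F \<subseteq> W \<inter> S" for U F
    unfolding base_def using that by (intro CollectI exI[of _ U] exI[of _ F]) simp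
  have "{} \<in> base"
  proof (rule ccontr)
    assume ne: "{} \<notin> base"
    have "\<exists>q\<in>ultrafilters_on S. base \<subseteq> q"
    proof (rule ultrafilter_exists_filter_base[OF _ _ ne])
      show "base \<subseteq> Pow S" by (auto simp: base_def)
      show "base \<noteq> {}" using base_memI[of T "{}"] nbhds0_self[OF zero_T] by auto
      fix B C assume "B \<in> base" "C \<in> base"
      then obtain U F V G where B: "B = U \<inter> S - \<Union>(D ` F)" "U \<in> nbhds0 T" "finite F" "F \<subseteq> W \<inter> S"
        and C: "C = V \<inter> S - \<Union>(D ` G)" "V \<in> nbhds0 T" "finite G" "G \<subseteq> W \<inter> S"
        unfolding base_def by (elim CollectE exE conjE)
      have "(U \<inter> V) \<inter> S - \<Union>(D ` (F \<union> G)) \<in> base"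
        using B C nbhds0_Int[OF zero_T] by (intro base_memI) simp_all
      moreover have "(U \<inter> V) \<inter> S - \<Union>(D ` (F \<union> G)) \<subseteq> B \<inter> C"
        unfolding B(1) C(1) by auto
      ultimately show "\<exists>X\<in>base. X \<subseteq> B \<inter> C" by (rule bexI[rotated])
    qed
    then obtain q where q: "q \<in> ultrafilters_on S" "base \<subseteq> q" by (rule bexE)
    have "U \<inter> S \<in> q" if "U \<in> nbhds0 T" for U
      using base_memI[OF that, of "{}"] q(2) by (simp add: subset_iff)
    then have qE: "q \<in> ufs_near0 T S" using q(1) by (simp add: ufs_near0_def)
    have "uf_add S q p \<in> L"
      using L qE by (simp add: minimal_left_ideal_def left_ideal_def)
    \<comment> \<open>The left ideal generated by \<open>q + p\<close> is all of \<open>L\<close>,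
      so it contains \<open>p\<close>.\<close>
    from minimal_left_ideal_eq[OF L(1) this]
    have "p \<in> (\<lambda>r. uf_add S r (uf_add S q p)) ` ufs_near0 T S" using L(2) by simp
    then obtain r where r: "r \<in> ufs_near0 T S" "p = uf_add S r (uf_add S q p)"
      by (rule imageE)
    have "A \<in> uf_add S r (uf_add S q p)" using A r(2) by simp
    then have "{t \<in> S. translate S t A \<in> uf_add S q p} \<in> r"
      using AS by (simp add: mem_uf_add_iff)
    then have "(W \<inter> S) \<inter> {t \<in> S. translate S t A \<in> uf_add S q p} \<noteq> {}"
      using uf_nonempty[OF ufs_near0_subset[OF r(1)]] uf_Int[OF ufs_near0_subset[OF r(1)]]
        ufs_near0_nbhds0[OF r(1) W] by simp
    then obtain t where t: "t \<in> W \<inter> S" "translate S t A \<in> uf_add S q p" by blast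
    have "{g \<in> S. translate S g (translate S t A) \<in> p} = D t"
      unfolding D_def using translate_translate by auto
    then have Dt: "D t \<in> q"
      using t(2) by (simp add: mem_uf_add_iff[OF translate_subset])
    \<comment> \<open>The base was built to put the complement of each \<open>D t\<close> into
      \<open>q\<close>, which now contradicts \<open>D t \<in> q\<close>.\<close>
    have "T \<inter> S - \<Union>(D ` {t}) \<in> q"
      using base_memI[OF nbhds0_self[OF zero_T], of "{t}"] q(2) t(1) by (simp add: subset_iff)
    from uf_nonempty[OF q(1) uf_Int[OF q(1) Dt this]]
    have "D t \<inter> (T \<inter> S - \<Union>(D ` {t})) \<noteq> {}" .
    then show False by simp
  qed
  then obtain U F where UF: "U \<inter> S - \<Union>(D ` F) = {}" "U \<in> nbhds0 T" "finite F" "F \<subseteq> W \<inter> S"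
    unfolding base_def by (elim CollectE exE conjE) simp
  show ?thesis
  proof (rule that)
    show "F \<noteq> {}" using UF(1) nbhds0_meets[OF UF(2)] by auto
    show "U \<inter> W \<in> nbhds0 T" by (rule nbhds0_Int[OF zero_T UF(2) W])
    show "\<exists>t\<in>F. {x \<in> S. t + (g + x) \<in> A} \<in> p" if "g \<in> (U \<inter> W) \<inter> S" for g
    proof -
      have "g \<in> \<Union>(D ` F)" using UF(1) that by auto
      then show ?thesis by (auto simp: D_def)
    qed
  qed (use UF in auto)
qed

text \<open>
  Piecewise syndeticity constrains \<open>x\<close> at all scales \<open>n\<close> at once; by this finiteness only finitely many
  conditions are active for a given \<open>G\<close>.
\<close>

lemma finite_base_indices:
  assumes W: "decreasing_base0 T W" and g: "g \<in> S"
  shows "finite {n. g \<in> W n}"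
proof -
  have "T - {g} \<in> nbhds0 T"
    using g zero_notin zero_T by (auto simp: nbhds0_iff intro!: exI[of _ "- {g}"])
  then obtain n where n: "W n \<subseteq> T - {g}" using W by (auto simp: decreasing_base0_def)
  have "m < n" if "g \<in> W m" for m
  proof (rule ccontr)
    assume "\<not> m < n"
    then have "W m \<subseteq> W n" using W by (auto simp: decreasing_base0_def decseq_def)
    then show False using n that by blast
  qed
  then have "{n. g \<in> W n} \<subseteq> {..<n}" by auto
  then show ?thesis by (rule finite_subset) simp
qed

text \<open>The sets \<open>F n\<close> and \<open>V n\<close> come from the return times of
  \<open>p\<close> to \<open>A\<close> inside \<open>W n\<close>. For a given \<open>G\<close> the
  requirements on \<open>x\<close> are finitely many, each holding on a member of \<open>p\<close>,
  so they can be met together inside \<open>U\<close>.\<close>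

lemma ps_near0_if_smallest_ideal:
  assumes p: "p \<in> smallest_ideal (uf_add S) (ufs_near0 T S)" and A: "A \<in> p"
  shows "ps_near0 T S A"
proof -
  have pu: "p \<in> ultrafilters_on S" using p smallest_ideal_near0 ufs_near0_subset by blast
  have pE: "p \<in> ufs_near0 T S" using p smallest_ideal_near0 by blast
  obtain W where W: "decreasing_base0 T W" using decreasing_base0_exists[OF zero_T] by blast
  have Wn: "W n \<in> nbhds0 T" for n using W by (simp add: decreasing_base0_def)
  define good where "good n F V \<longleftrightarrow> (finite F \<and> F \<noteq> {} \<and> F \<subseteq> W n \<inter> S) \<and>
      (V \<in> nbhds0 T \<and> V \<subseteq> W n) \<and> (\<forall>g\<in>V \<inter> S. \<exists>t\<in>F. {x \<in> S. t + (g + x) \<in> A} \<in> p)" for n F V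
  have "\<exists>F V. good n F V" for n
  proof (rule return_times_near0[OF p A Wn[of n]])
    fix F V assume "finite F" "F \<noteq> {}" "F \<subseteq> W n \<inter> S" "V \<in> nbhds0 T" "V \<subseteq> W n"
      "\<And>g. g \<in> V \<inter> S \<Longrightarrow> \<exists>t\<in>F. {x \<in> S. t + (g + x) \<in> A} \<in> p"
    then have "good n F V" unfolding good_def by (intro conjI ballI)
    then show "\<exists>F V. good n F V" by (intro exI)
  qed
  then obtain F V where good: "\<And>n. good n (F n) (V n)" by metis
  have F: "finite (F n) \<and> F n \<noteq> {} \<and> F n \<subseteq> W n \<inter> S"
    and V: "V n \<in> nbhds0 T \<and> V n \<subseteq> W n" for n
    using good[of n] unfolding good_def by simp_all
  have FV: "\<exists>t\<in>F n. {x \<in> S. t + (g + x) \<in> A} \<in> p" if "g \<in> V n \<inter> S" for n g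
    using good[of n] that unfolding good_def by (elim conjE) (rule bspec)
  have "\<exists>x\<in>U \<inter> S. \<forall>n. (\<lambda>g. g + x) ` (G \<inter> V n) \<subseteq> (\<Union>t\<in>F n. translate S t A)"
    if G: "finite G" "G \<subseteq> S" and U: "U \<in> nbhds0 T" for G U
  proof -
    \<comment> \<open>The active pairs of an element of \<open>G\<close> and a scale; there are
      finitely many because each element lies in only finitely many \<open>W n\<close>.\<close>
    define I where "I = (SIGMA g:G. {n. g \<in> V n})"
    have "{n. g \<in> V n} \<subseteq> {n. g \<in> W n}" for g using V by auto
    then have "finite {n. g \<in> V n}" if "g \<in> G" for g
      using finite_base_indices[OF W] finite_subset that G(2) by (metis subsetD)
    then have "finite I" unfolding I_def using G(1) by (intro finite_SigmaI)
    have "\<exists>t. t \<in> F (snd i) \<and> {x \<in> S. t + (fst i + x) \<in> A} \<in> p" if "i \<in> I" for i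
    proof -
      have "fst i \<in> V (snd i) \<inter> S" using that G(2) by (auto simp: I_def)
      from FV[OF this] show ?thesis by blast
    qed
    then obtain t where t: "\<And>i. i \<in> I \<Longrightarrow> t i \<in> F (snd i) \<and> {x \<in> S. t i + (fst i + x) \<in> A} \<in> p"
      by metis
    have "(U \<inter> S) \<inter> (S \<inter> (\<Inter>i\<in>I. {x \<in> S. t i + (fst i + x) \<in> A})) \<in> p"
      using uf_Int[OF pu ufs_near0_nbhds0[OF pE U]] uf_INT[OF pu \<open>finite I\<close>] t by simp
    then have "(U \<inter> S) \<inter> (S \<inter> (\<Inter>i\<in>I. {x \<in> S. t i + (fst i + x) \<in> A})) \<noteq> {}"
      by (rule uf_nonempty[OF pu])
    then obtain x where x: "x \<in> U \<inter> S" "\<And>i. i \<in> I \<Longrightarrow> t i + (fst i + x) \<in> A" by auto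
    have "(\<lambda>g. g + x) ` (G \<inter> V n) \<subseteq> (\<Union>t\<in>F n. translate S t A)" for n
    proof
      fix y assume "y \<in> (\<lambda>g. g + x) ` (G \<inter> V n)"
      then obtain g where g: "g \<in> G" "g \<in> V n" "y = g + x" by auto
      then have "(g, n) \<in> I" by (simp add: I_def)
      then have "t (g, n) \<in> F n" "t (g, n) + (g + x) \<in> A" using t x(2) by force+
      moreover have "g + x \<in> S" using g x(1) G(2) add_S by auto
      ultimately show "y \<in> (\<Union>t\<in>F n. translate S t A)" using g(3) by (auto simp: translate_def)
    qed
    then show ?thesis using x(1) by blast
  qed
  then show ?thesis
    unfolding ps_near0_def using uf_subset[OF pu A] W F V
    by (intro conjI exI[of _ W] exI[of _ F] exI[of _ V]) simp_all
qed

text \<open>The admissible \<open>x\<close> generate an ultrafilter \<open>p\<close> near zero that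
  contains \<open>-g + C n\<close> whenever \<open>g \<in> V n \<inter> S\<close>. Adding a minimal
  \<open>q\<close> on the left gives a minimal \<open>r\<close> that contains every
  \<open>C n\<close>. Since \<open>C n\<close> is a finite union, some \<open>-t + A\<close> with
  \<open>t \<in> F n\<close> lies in \<open>r\<close>; such \<open>t\<close> approach zero, and an
  ultrafilter \<open>u\<close> on them puts \<open>A\<close> into the minimal
  \<open>u + r\<close>.\<close>

lemma smallest_ideal_if_ps_near0:
  assumes "ps_near0 T S A"
  obtains p where "p \<in> smallest_ideal (uf_add S) (ufs_near0 T S)" "A \<in> p"
proof -
  obtain W F V where AS: "A \<subseteq> S" and W: "decreasing_base0 T W"
    and F: "\<And>n. finite (F n) \<and> F n \<noteq> {} \<and> F n \<subseteq> W n \<inter> S"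
    and V: "\<And>n. V n \<in> nbhds0 T \<and> V n \<subseteq> W n"
    and ps: "\<And>G U. \<lbrakk>finite G; G \<noteq> {}; G \<subseteq> S; U \<in> nbhds0 T\<rbrakk> \<Longrightarrow>
      \<exists>x\<in>U \<inter> S. \<forall>n. (\<lambda>g. g + x) ` (G \<inter> V n) \<subseteq> (\<Union>t\<in>F n. translate S t A)"
    using assms unfolding ps_near0_def by (elim conjE exE) metis
  define C where "C n = (\<Union>t\<in>F n. translate S t A)" for n
  have CS: "C n \<subseteq> S" for n unfolding C_def using translate_subset by (rule UN_least)
  \<comment> \<open>The points \<open>x\<close> that serve \<open>G\<close> and \<open>U\<close> at
    all scales at once. Enlarging \<open>G\<close> and shrinking \<open>U\<close> shrinks this set,
    hence the filter base.\<close>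
  define Z where "Z G U = {x \<in> U \<inter> S. \<forall>n. (\<lambda>g. g + x) ` (G \<inter> V n) \<subseteq> C n}" for G U
  define base where "base = {Z G U |G U. finite G \<and> G \<noteq> {} \<and> G \<subseteq> S \<and> U \<in> nbhds0 T}"
  have base_memI: "Z G U \<in> base" if "finite G" "G \<noteq> {}" "G \<subseteq> S" "U \<in> nbhds0 T" for G U
    unfolding base_def using that by (intro CollectI exI[of _ G] exI[of _ U]) simp
  obtain s where s: "s \<in> S" using nbhds0_meets[OF nbhds0_self[OF zero_T]] by blast
  have "\<exists>p\<in>ultrafilters_on S. base \<subseteq> p"
  proof (rule ultrafilter_exists_filter_base)
    show "base \<subseteq> Pow S" by (auto simp: base_def Z_def)
    show "base \<noteq> {}" using base_memI[of "{s}" T] s nbhds0_self[OF zero_T] by auto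
    have "Z G U \<noteq> {}" if "finite G" "G \<noteq> {}" "G \<subseteq> S" "U \<in> nbhds0 T" for G U
      using ps[OF that] unfolding Z_def C_def by blast
    then show "{} \<notin> base" unfolding base_def by (auto simp del: ex_simps)
    fix B D assume "B \<in> base" "D \<in> base"
    then obtain G U H O' where B: "B = Z G U" "finite G" "G \<noteq> {}" "G \<subseteq> S" "U \<in> nbhds0 T"
      and D: "D = Z H O'" "finite H" "H \<noteq> {}" "H \<subseteq> S" "O' \<in> nbhds0 T"
      unfolding base_def by (elim CollectE exE conjE)
    have "Z (G \<union> H) (U \<inter> O') \<in> base"
      using B D nbhds0_Int[OF zero_T] by (intro base_memI) simp_all
    moreover have "Z (G \<union> H) (U \<inter> O') \<subseteq> B \<inter> D"
      unfolding B(1) D(1) Z_def by auto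
    ultimately show "\<exists>X\<in>base. X \<subseteq> B \<inter> D" by (rule bexI[rotated])
  qed
  then obtain p where pu: "p \<in> ultrafilters_on S" and "base \<subseteq> p" by (rule bexE)
  have Zp: "Z G U \<in> p" if "finite G" "G \<noteq> {}" "G \<subseteq> S" "U \<in> nbhds0 T" for G U
    using base_memI[OF that] \<open>base \<subseteq> p\<close> by (rule subsetD[rotated])
  have "U \<inter> S \<in> p" if "U \<in> nbhds0 T" for U
    by (rule uf_mono[OF pu Zp[of "{s}" U]]) (use that s in \<open>auto simp: Z_def\<close>)
  then have pE: "p \<in> ufs_near0 T S" using pu by (simp add: ufs_near0_def)
  have "smallest_ideal (uf_add S) (ufs_near0 T S) \<noteq> {}"
    using two_sided_ideal_smallest_ideal by (simp add: two_sided_ideal_def)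
  then obtain q where q: "q \<in> smallest_ideal (uf_add S) (ufs_near0 T S)" by blast
  define r where "r = uf_add S q p"
  have r: "r \<in> smallest_ideal (uf_add S) (ufs_near0 T S)"
    unfolding r_def by (rule smallest_ideal_add_right[OF pE q])
  have qE: "q \<in> ufs_near0 T S" and rE: "r \<in> ufs_near0 T S" using q r smallest_ideal_near0 by blast+
  have Cr: "C n \<in> r" for n
  proof -
    have "translate S g (C n) \<in> p" if g: "g \<in> V n \<inter> S" for g
      by (rule uf_mono[OF pu Zp[of "{g}" T]])
        (use g nbhds0_self[OF zero_T] in \<open>auto simp: Z_def translate_def\<close>)
    then have "V n \<inter> S \<subseteq> {g \<in> S. translate S g (C n) \<in> p}"
      by (intro subsetI CollectI conjI) blast+
    then have "{g \<in> S. translate S g (C n) \<in> p} \<in> q"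
      using V by (intro uf_mono[OF ufs_near0_subset[OF qE] ufs_near0_nbhds0[OF qE]]) auto
    then show ?thesis by (simp add: r_def mem_uf_add_iff[OF CS])
  qed
  \<comment> \<open>Every neighborhood of zero contains some \<open>W n\<close>, hence all of
    \<open>F n\<close>, and one \<open>t\<close> there belongs to \<open>D\<close>.\<close>
  define D where "D = {t \<in> S. translate S t A \<in> r}"
  have "U \<inter> D \<noteq> {}" if U: "U \<in> nbhds0 T" for U
  proof -
    obtain n where n: "W n \<subseteq> U" using W U by (auto simp: decreasing_base0_def)
    obtain t where "t \<in> F n" "translate S t A \<in> r"
      using uf_UN[OF ufs_near0_subset[OF rE], of "F n" "\<lambda>t. translate S t A"] F translate_subset
        Cr[of n] unfolding C_def by blast
    then show ?thesis using F[of n] n by (auto simp: D_def)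
  qed
  moreover have "D \<subseteq> S" by (auto simp: D_def)
  ultimately obtain u where u: "u \<in> ufs_near0 T S" "D \<in> u"
    using uf_near0_exists by blast
  have "A \<in> uf_add S u r" using u(2) by (simp add: mem_uf_add_iff[OF AS] D_def)
  then show ?thesis using that smallest_ideal_add_left[OF u(1) r] by blast
qed

section \<open>IP sets and idempotent ultrafilters\<close>

lemma idempotent_if_ip_near0:
  assumes "ip_near0 T S A"
  obtains p where "p \<in> ufs_near0 T S" "uf_add S p p = p" "A \<in> p"
proof -
  have AS: "A \<subseteq> S" using assms by (simp add: ip_near0_def)
  obtain x :: "nat \<Rightarrow> 'a" where x: "range x \<subseteq> S"
    and near': "\<forall>U\<in>nbhds0 T. \<exists>m. \<forall>F. finite F \<and> F \<noteq> {} \<and> F \<subseteq> {m..} \<longrightarrow> (\<Sum>n\<in>F. x n) \<in> U"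
    and FSA': "\<forall>F. finite F \<and> F \<noteq> {} \<longrightarrow> (\<Sum>n\<in>F. x n) \<in> A"
    using assms unfolding ip_near0_def by (elim conjE exE)
  note near = bspec[OF near']
  have FSA: "(\<Sum>n\<in>F. x n) \<in> A" if "finite F" "F \<noteq> {}" for F
    using FSA' that by simp
  define FS where "FS m = {\<Sum>n\<in>F. x n |F. finite F \<and> F \<noteq> {} \<and> F \<subseteq> {m..}}" for m
  have FSI: "(\<Sum>n\<in>F. x n) \<in> FS m" if "finite F" "F \<noteq> {}" "F \<subseteq> {m..}" for F m
    unfolding FS_def using that by (intro CollectI exI[of _ F]) simp
  have FSE: "\<exists>F. y = (\<Sum>n\<in>F. x n) \<and> finite F \<and> F \<noteq> {} \<and> F \<subseteq> {m..}" if "y \<in> FS m" for y m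
    using that unfolding FS_def by (rule CollectD)
  have FS_A: "FS m \<subseteq> A" for m
  proof
    fix y assume "y \<in> FS m"
    from FSE[OF this] show "y \<in> A" using FSA by (elim exE conjE) simp
  qed
  have FS_subset: "FS m \<subseteq> S" for m using FS_A AS by (rule subset_trans)
  have FS_mono: "FS n \<subseteq> FS m" if "m \<le> n" for m n
  proof
    fix y assume "y \<in> FS n"
    from FSE[OF this] obtain F where F: "y = (\<Sum>n\<in>F. x n)" "finite F" "F \<noteq> {}" "F \<subseteq> {n..}"
      by (elim exE conjE)
    have "{n..} \<subseteq> {m..}" using that by simp
    then have "F \<subseteq> {m..}" using F(4) by (rule subset_trans[rotated])
    then show "y \<in> FS m" unfolding F(1) by (rule FSI[OF F(2,3)])
  qed
  have FS_U: "\<exists>m. FS m \<subseteq> U" if U: "U \<in> nbhds0 T" for U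
  proof -
    obtain m where m: "\<forall>F. finite F \<and> F \<noteq> {} \<and> F \<subseteq> {m..} \<longrightarrow> (\<Sum>n\<in>F. x n) \<in> U"
      using near[OF U] ..
    have "FS m \<subseteq> U"
    proof
      fix y assume "y \<in> FS m"
      from FSE[OF this] show "y \<in> U" using m by (elim exE conjE) simp
    qed
    then show ?thesis ..
  qed
  \<comment> \<open>The ultrafilters containing the finite sums of every tail form a nonempty closed
    subsemigroup. Its idempotents contain \<open>A\<close>, since all these sums lie in
    \<open>A\<close>.\<close>
  define Q where "Q = (\<Inter>m. {p \<in> ufs_near0 T S. FS m \<in> p})"
  have QI: "p \<in> Q" if "p \<in> ufs_near0 T S" "\<And>m. FS m \<in> p" for p
    using that by (simp add: Q_def)
  have QD: "p \<in> ufs_near0 T S" "FS m \<in> p" if "p \<in> Q" for p m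
    using that by (simp_all add: Q_def)
  have "closedin (near0_topology T S) Q"
    unfolding Q_def using FS_subset by (intro closedin_INT closedin_near0_basic) auto
  moreover have "Q \<noteq> {}"
  proof -
    have "\<exists>p\<in>ultrafilters_on S. range FS \<subseteq> p"
    proof (rule ultrafilter_exists_filter_base)
      show "range FS \<subseteq> Pow S" using FS_subset by auto
      have "x m \<in> FS m" for m using FSI[of "{m}" m] by simp
      then show "{} \<notin> range FS" by (metis empty_iff imageE)
      fix B C assume "B \<in> range FS" "C \<in> range FS"
      then obtain m n where "B = FS m" "C = FS n" by (elim rangeE)
      then have "FS (max m n) \<subseteq> B \<inter> C" using FS_mono by simp
      then show "\<exists>X\<in>range FS. X \<subseteq> B \<inter> C" by (rule bexI) simp
    qed simp
    then obtain p where pu: "p \<in> ultrafilters_on S" and "range FS \<subseteq> p" by (rule bexE)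
    then have FSp: "FS m \<in> p" for m by auto
    have "U \<inter> S \<in> p" if U: "U \<in> nbhds0 T" for U
    proof -
      obtain m where "FS m \<subseteq> U" using FS_U[OF U] ..
      then show ?thesis using uf_mono[OF pu FSp[of m], of "U \<inter> S"] FS_subset by simp
    qed
    then have "p \<in> Q" using pu FSp by (intro QI) (simp_all add: ufs_near0_def)
    then show ?thesis by blast
  qed
  moreover have "uf_add S p q \<in> Q" if p: "p \<in> Q" and q: "q \<in> Q" for p q
  proof (rule QI)
    show "uf_add S p q \<in> ufs_near0 T S" using uf_add_near0 QD p q by blast
    fix m
    note pu = ufs_near0_subset[OF QD(1)[OF p]] and qu = ufs_near0_subset[OF QD(1)[OF q]]
    have "translate S s (FS m) \<in> q" if sFS: "s \<in> FS m" for s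
    proof -
      obtain F where F: "finite F" "F \<noteq> {}" "F \<subseteq> {m..}" "s = (\<Sum>n\<in>F. x n)"
        using FSE[OF sFS] by (elim exE conjE)
      \<comment> \<open>Starting past the largest index of \<open>F\<close> keeps the index sets
        disjoint, so adding two finite sums gives a finite sum again.\<close>
      define k where "k = Suc (Max F)"
      have "FS k \<subseteq> translate S s (FS m)"
      proof
        fix y assume y: "y \<in> FS k"
        obtain G where G: "finite G" "G \<noteq> {}" "G \<subseteq> {k..}" "y = (\<Sum>n\<in>G. x n)"
          using FSE[OF y] by (elim exE conjE)
        have less: "i < j" if "i \<in> F" "j \<in> G" for i j
        proof -
          have "i \<le> Max F" "k \<le> j" using that F(1) G(3) by auto
          then show ?thesis by (simp add: k_def)
        qed
        then have "F \<inter> G = {}" by blast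
        then have "s + y = (\<Sum>n\<in>F \<union> G. x n)"
          using F G by (simp add: sum.union_disjoint)
        moreover have "G \<subseteq> {m..}"
        proof
          fix j assume "j \<in> G"
          obtain i where "i \<in> F" using F(2) by blast
          then show "j \<in> {m..}" using less[OF _ \<open>j \<in> G\<close>, of i] F(3) by auto
        qed
        ultimately have "s + y \<in> FS m" using F G FSI[of "F \<union> G" m] by simp
        then show "y \<in> translate S s (FS m)" using y FS_subset by (auto simp: translate_def)
      qed
      then show ?thesis by (rule uf_mono[OF qu QD(2)[OF q] _ translate_subset])
    qed
    then have "FS m \<subseteq> {s \<in> S. translate S s (FS m) \<in> q}" using FS_subset by auto
    then have "{s \<in> S. translate S s (FS m) \<in> q} \<in> p"
      by (rule uf_mono[OF pu QD(2)[OF p]]) simp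
    then show "FS m \<in> uf_add S p q" by (simp add: mem_uf_add_iff[OF FS_subset])
  qed
  ultimately obtain p where p: "p \<in> Q" "uf_add S p p = p"
    using idempotent_exists by blast
  have "A \<in> p"
    by (rule uf_mono[OF ufs_near0_subset[OF QD(1)[OF p(1)]] QD(2)[OF p(1)] FS_A AS])
  then show ?thesis using that p QD(1) by blast
qed

lemma ip_near0_if_idempotent:
  assumes pE: "p \<in> ufs_near0 T S" and idem: "uf_add S p p = p" and A: "A \<in> p"
  shows "ip_near0 T S A"
proof -
  note pu = ufs_near0_subset[OF pE]
  have AS: "A \<subseteq> S" by (rule uf_subset[OF pu A])
  obtain W where W: "decreasing_base0 T W" using decreasing_base0_exists[OF zero_T] by blast
  have ex: "\<exists>s\<in>B. translate S s B \<in> p" if B: "B \<in> p" for B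
  proof -
    have "{s \<in> S. translate S s B \<in> p} \<in> p"
      using B idem mem_uf_add_iff[OF uf_subset[OF pu B], of p p] by simp
    then have "B \<inter> {s \<in> S. translate S s B \<in> p} \<noteq> {}"
      using uf_nonempty[OF pu] uf_Int[OF pu B] by simp
    then show ?thesis by blast
  qed
  define c where "c B = (SOME s. s \<in> B \<and> translate S s B \<in> p)" for B
  have c: "c B \<in> B" "translate S (c B) B \<in> p" if "B \<in> p" for B
    using someI_ex[of "\<lambda>s. s \<in> B \<and> translate S s B \<in> p"] ex[OF that] unfolding c_def by blast+
  txt \<open>Galvin's argument: shrinking \<open>B\<close> at each step keeps all sums with least index \<open>n\<close> inside \<open>B n\<close>.\<close>
  define B where "B = rec_nat A (\<lambda>n B. B \<inter> translate S (c B) B \<inter> (W n \<inter> S))"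
  have B0: "B 0 = A" and BSuc: "B (Suc n) = B n \<inter> translate S (c (B n)) (B n) \<inter> (W n \<inter> S)" for n
    by (simp_all add: B_def)
  have Bp: "B n \<in> p" for n
  proof (induction n)
    case (Suc n)
    have "W n \<inter> S \<in> p" using W by (intro ufs_near0_nbhds0[OF pE]) (simp add: decreasing_base0_def)
    then show ?case unfolding BSuc using uf_Int[OF pu] c(2) Suc by simp
  qed (simp add: B0 A)
  have dec: "decseq B" by (rule decseq_SucI) (auto simp: BSuc)
  define x where "x n = c (B n)" for n
  have xB: "x n \<in> B n" for n using c(1)[OF Bp] by (simp add: x_def)
  have sums: "(\<Sum>n\<in>F. x n) \<in> B m" if "finite F" "F \<noteq> {}" "F \<subseteq> {m..}" for F m
    using that
  \<comment> \<open>The induction removes the least index \<open>b\<close>. The remaining sum lies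
    in \<open>B (Suc b)\<close>, which is inside \<open>-x b + B b\<close> by construction.\<close>
  proof (induction F arbitrary: m rule: finite_linorder_min_induct)
    case (insert b F)
    have "B b \<subseteq> B m" using dec insert.prems by (auto simp: decseq_def)
    moreover have "(\<Sum>n\<in>insert b F. x n) \<in> B b"
    proof (cases "F = {}")
      case True
      then show ?thesis using xB by simp
    next
      case False
      have "F \<subseteq> {Suc b..}" using insert.hyps(2) by auto
      then have "(\<Sum>n\<in>F. x n) \<in> B (Suc b)" using insert.IH False by simp
      then have "x b + (\<Sum>n\<in>F. x n) \<in> B b"
        by (simp add: BSuc translate_def x_def)
      moreover have "b \<notin> F" using insert.hyps(2) by blast
      ultimately show ?thesis using insert.hyps(1) by simp
    qed
    ultimately show ?case by blast
  qed simp
  have "\<exists>m. \<forall>F. finite F \<and> F \<noteq> {} \<and> F \<subseteq> {m..} \<longrightarrow> (\<Sum>n\<in>F. x n) \<in> U" if U: "U \<in> nbhds0 T" for U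
  proof -
    obtain n where "W n \<subseteq> U" using W U by (auto simp: decreasing_base0_def)
    \<comment> \<open>\<open>W n\<close> enters the construction at stage \<open>Suc n\<close>, so
      this is where the tail has to start.\<close>
    then have "B (Suc n) \<subseteq> U" by (auto simp: BSuc)
    then show ?thesis using sums by (intro exI[of _ "Suc n"]) blast
  qed
  moreover have "(\<Sum>n\<in>F. x n) \<in> A" if "finite F" "F \<noteq> {}" for F
    using sums[OF that, of 0] B0 by simp
  moreover have "range x \<subseteq> S" using xB uf_subset[OF pu Bp] by auto
  ultimately show ?thesis using AS unfolding ip_near0_def by blast
qed

end

section \<open>Arithmetic progressions\<close>

locale near_zero_reals =
  fixes S :: "real set"
  assumes pos: "S \<subseteq> {0<..}" and add: "\<lbrakk>x \<in> S; y \<in> S\<rbrakk> \<Longrightarrow> x + y \<in> S"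
    and near: "0 \<in> closure S"
begin

sublocale R: near_zero_semigroup "{0..}" S
  using pos near by unfold_locales (auto simp: add)

sublocale P: near_zero_semigroup "{0..} \<times> {0..}" "S \<times> S"
  using pos near by unfold_locales (auto simp: add zero_prod_def closure_Times)

section \<open>Ultrafilters on pairs and their images along the terms of a progression\<close>

definition lin :: "nat \<Rightarrow> real \<times> real \<Rightarrow> real" where
  "lin k z = fst z + real k * snd z"

lemma lin_mem: "z \<in> S \<times> S \<Longrightarrow> lin k z \<in> S"
proof (induction k)
  case (Suc k)
  have "lin (Suc k) z = lin k z + snd z" by (simp add: lin_def algebra_simps)
  then show ?case using Suc add by auto
qed (auto simp: lin_def)

abbreviation E1 where "E1 \<equiv> ufs_near0 {0..} S"
abbreviation E2 where "E2 \<equiv> ufs_near0 ({0..} \<times> {0..}) (S \<times> S)"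
abbreviation K1 where "K1 \<equiv> smallest_ideal (uf_add S) E1"
abbreviation K2 where "K2 \<equiv> smallest_ideal (uf_add (S \<times> S)) E2"
abbreviation push where "push k \<equiv> uf_map (S \<times> S) S (lin k)"

lemma push_near: "q \<in> E2 \<Longrightarrow> push k q \<in> E1"
  unfolding lin_def
  by (rule uf_map_near0)
    (auto simp: lin_mem[unfolded lin_def] zero_prod_def intro!: continuous_intros)

lemma push_add: "push k (uf_add (S \<times> S) p q) = uf_add S (push k p) (push k q)"
  unfolding uf_add_eq_uf_prod
  by (rule uf_map_uf_prod) (auto simp: add lin_mem, auto simp: lin_def algebra_simps)

text \<open>\<open>act_right\<close> and \<open>act_left\<close> are addition of \<open>(p, 0)\<close>; the pair lives on \<open>S \<times> {0}\<close>, outside \<open>S \<times> S\<close>.\<close>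

definition act_right where
  "act_right x p = uf_prod (S \<times> S) S (S \<times> S) (\<lambda>z t. (fst z + t, snd z)) x p"

definition act_left where
  "act_left p x = uf_prod S (S \<times> S) (S \<times> S) (\<lambda>t z. (t + fst z, snd z)) p x"

lemma act_right_near: "\<lbrakk>x \<in> E2; p \<in> E1\<rbrakk> \<Longrightarrow> act_right x p \<in> E2"
  unfolding act_right_def
  by (rule uf_prod_near0) (auto simp: add zero_prod_def intro!: continuous_intros)

lemma act_left_near: "\<lbrakk>p \<in> E1; x \<in> E2\<rbrakk> \<Longrightarrow> act_left p x \<in> E2"
  unfolding act_left_def
  by (rule uf_prod_near0) (auto simp: add zero_prod_def intro!: continuous_intros)

lemma add_act_right: "uf_add (S \<times> S) x (act_right y p) = act_right (uf_add (S \<times> S) x y) p"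
  unfolding act_right_def uf_add_eq_uf_prod
  by (rule uf_prod_assoc[symmetric]) (auto simp: add prod_eq_iff)

lemma act_left_add: "uf_add (S \<times> S) (act_left p x) y = act_left p (uf_add (S \<times> S) x y)"
  unfolding act_left_def uf_add_eq_uf_prod
  by (rule uf_prod_assoc) (auto simp: add prod_eq_iff)

text \<open>The action moves only the first coordinate, and every term \<open>a + k d\<close>
  contains it with coefficient one. The image is thus shifted by the same \<open>p\<close> for every
  \<open>k\<close>.\<close>

lemma push_act_right:
  assumes "p \<in> E1"
  shows "push k (act_right x p) = uf_add S (push k x) p"
proof -
  have "push k (act_right x p) = uf_prod S S S (+) (push k x) (uf_map S S (\<lambda>t. t) p)"
    unfolding act_right_def
    by (rule uf_map_uf_prod) (auto simp: add lin_mem, auto simp: lin_def)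
  then show ?thesis
    using uf_map_id[OF ufs_near0_subset[OF assms]] by (simp add: uf_add_eq_uf_prod)
qed

lemma push_act_left:
  assumes "p \<in> E1"
  shows "push k (act_left p x) = uf_add S p (push k x)"
proof -
  have "push k (act_left p x) = uf_prod S S S (+) (uf_map S S (\<lambda>t. t) p) (push k x)"
    unfolding act_left_def
    by (rule uf_map_uf_prod) (auto simp: add lin_mem, auto simp: lin_def)
  then show ?thesis
    using uf_map_id[OF ufs_near0_subset[OF assms]] by (simp add: uf_add_eq_uf_prod)
qed

lemma push_smallest_ideal:
  assumes "q \<in> K2"
  shows "push k q \<in> K1"
proof -
  define I where "I = {q \<in> E2. push k q \<in> K1}"
  have "two_sided_ideal (uf_add (S \<times> S)) E2 I"
    unfolding two_sided_ideal_def
  proof (intro conjI ballI)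
    \<comment> \<open>The preimage of \<open>K1\<close> must be shown to be nonempty:
      \<open>x + (p, 0)\<close> is sent to \<open>push k x + p\<close>, which lies in
      \<open>K1\<close>.\<close>
    obtain p x where p: "p \<in> K1" and x: "x \<in> E2"
      using R.two_sided_ideal_smallest_ideal P.nonempty by (auto simp: two_sided_ideal_def)
    have pE: "p \<in> E1" using p R.smallest_ideal_near0 by blast
    have "act_right x p \<in> I"
      using act_right_near[OF x pE] push_act_right[OF pE]
        R.smallest_ideal_add_left[OF push_near[OF x] p]
      by (simp add: I_def)
    then show "I \<noteq> {}" by blast
    show "I \<subseteq> E2" by (simp add: I_def)
    fix x y assume "x \<in> E2" "y \<in> I"
    then show "uf_add (S \<times> S) x y \<in> I" "uf_add (S \<times> S) y x \<in> I"
      using P.uf_add_near0 R.smallest_ideal_add_left R.smallest_ideal_add_right push_near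
      by (simp_all add: I_def push_add)
  qed
  then have "K2 \<subseteq> I" unfolding smallest_ideal_def by (intro Inter_lower) simp
  then show ?thesis using assms by (auto simp: I_def)
qed

lemma smallest_ideal_lift:
  assumes p: "p \<in> K1"
  obtains L q where "P.minimal_left_ideal L" "q \<in> L" "\<And>k. push k q = p"
proof -
  have pE: "p \<in> E1" using p R.smallest_ideal_near0 by blast
  obtain L1 where L1: "R.minimal_left_ideal L1" "p \<in> L1"
    using p R.smallest_ideal_eq by auto
  \<comment> \<open>This is the left ideal \<open>E2 + (p, 0)\<close>. Its elements have images in
    \<open>E1 + p\<close>, hence in the minimal left ideal of \<open>p\<close>, for all
    \<open>k\<close> at once.\<close>
  define J where "J = (\<lambda>x. act_right x p) ` E2"
  have "P.left_ideal J"
    unfolding P.left_ideal_def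
  proof (intro conjI ballI)
    show "J \<noteq> {}" using P.nonempty by (simp add: J_def)
    show "J \<subseteq> topspace (near0_topology ({0..} \<times> {0..}) (S \<times> S))"
      using act_right_near pE by (auto simp: J_def)
    fix x y assume x: "x \<in> topspace (near0_topology ({0..} \<times> {0..}) (S \<times> S))" and "y \<in> J"
    then obtain z where z: "z \<in> E2" "y = act_right z p" unfolding J_def by blast
    then have "uf_add (S \<times> S) x y = act_right (uf_add (S \<times> S) x z) p"
      by (simp add: add_act_right)
    then show "uf_add (S \<times> S) x y \<in> J"
      using P.uf_add_near0[of x z] x z(1) by (simp add: J_def)
  qed
  then obtain L where L: "P.minimal_left_ideal L" "L \<subseteq> J"
    using P.minimal_left_ideal_exists by blast
  have LE: "L \<subseteq> E2" and Lmult: "\<And>x y. \<lbrakk>x \<in> E2; y \<in> L\<rbrakk> \<Longrightarrow> uf_add (S \<times> S) x y \<in> L"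
    using L(1) by (simp_all add: P.minimal_left_ideal_def P.left_ideal_def)
  obtain e where e: "e \<in> L" "uf_add (S \<times> S) e e = e"
  proof (rule P.idempotent_exists[OF P.closedin_minimal_left_ideal[OF L(1)]])
    show "L \<noteq> {}" by (rule P.minimal_left_ideal_nonempty[OF L(1)])
    show "uf_add (S \<times> S) x y \<in> L" if "x \<in> L" "y \<in> L" for x y
      using Lmult LE that by blast
  qed
  obtain x where x: "x \<in> E2" "e = act_right x p" using e(1) L(2) unfolding J_def by blast
  have eE: "e \<in> E2" using e(1) LE by blast
  have "push k (act_left p e) = p" for k
  proof -
    have "push k e = uf_add S (push k x) p" using x(2) push_act_right[OF pE] by simp
    then have "push k e \<in> L1"
      using L1 push_near[OF x(1)] by (simp add: R.minimal_left_ideal_def R.left_ideal_def)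
    moreover have "uf_add S (push k e) (push k e) = push k e"
      using push_add[of k e e] e(2) by simp
    ultimately have "uf_add S p (push k e) = p"
      using R.idempotent_right_identity[OF L1(1)] L1(2) by blast
    then show ?thesis using push_act_left[OF pE] by simp
  qed
  \<comment> \<open>Because \<open>e\<close> is idempotent, \<open>(p, 0) + e\<close> equals
    \<open>((p, 0) + e) + e\<close>, which lies in the left ideal \<open>L\<close>.\<close>
  moreover have "act_left p e \<in> L"
    using Lmult[OF act_left_near[OF pE eE] e(1)] act_left_add[of p e e] e(2) by simp
  ultimately show ?thesis using that L(1) by blast
qed

text \<open>Since \<open>p\<close> is idempotent, the common fiber of all the maps
  \<open>push k\<close> over \<open>p\<close> is closed under addition. Its part in \<open>L\<close>
  is closed and contains the lift found before, so it contains an idempotent.\<close>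

lemma smallest_ideal_lift_idempotent:
  assumes p: "p \<in> K1" "uf_add S p p = p"
  obtains q where "q \<in> K2" "uf_add (S \<times> S) q q = q" "\<And>k. push k q = p"
proof -
  obtain L q where L: "P.minimal_left_ideal L" and q: "q \<in> L" "\<And>k. push k q = p"
    using smallest_ideal_lift[OF p(1)] by blast
  have LE: "L \<subseteq> E2" and Lmult: "\<And>x y. \<lbrakk>x \<in> E2; y \<in> L\<rbrakk> \<Longrightarrow> uf_add (S \<times> S) x y \<in> L"
    using L by (simp_all add: P.minimal_left_ideal_def P.left_ideal_def)
  \<comment> \<open>The singleton exhibits the fiber as the preimage of a closed set.\<close>
  define C where "C = L \<inter> (\<Inter>k. {q \<in> E2. push k q \<in> {p}})"
  have "closedin (near0_topology ({0..} \<times> {0..}) (S \<times> S)) {q \<in> E2. push k q \<in> {p}}" for k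
  proof -
    have "continuous_map (near0_topology ({0..} \<times> {0..}) (S \<times> S)) (uf_topology S) (push k)"
      unfolding near0_topology_def
      by (rule continuous_map_from_subtopology[OF continuous_map_uf_map[OF lin_mem]])
    moreover have "closedin (uf_topology S) {p}"
      using p(1) R.smallest_ideal_near0 ufs_near0_subset
      by (intro closedin_Hausdorff_singleton[OF Hausdorff_uf_topology]) auto
    ultimately show ?thesis
      using closedin_continuous_map_preimage by fastforce
  qed
  then have "closedin (near0_topology ({0..} \<times> {0..}) (S \<times> S)) C"
    unfolding C_def
    by (intro closedin_Int closedin_INT P.closedin_minimal_left_ideal[OF L]) auto
  moreover have "q \<in> C" using q LE by (auto simp: C_def)
  moreover have "uf_add (S \<times> S) x y \<in> C" if "x \<in> C" "y \<in> C" for x y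
    using that LE Lmult P.uf_add_near0[of x y] p(2) by (simp add: C_def push_add subset_iff)
  ultimately obtain r where r: "r \<in> C" "uf_add (S \<times> S) r r = r"
    using P.idempotent_exists by blast
  have "r \<in> K2" using r(1) L P.smallest_ideal_eq by (auto simp: C_def)
  then show ?thesis using that r by (simp add: C_def)
qed

section \<open>Transfer of the five notions of largeness\<close>

lemma ap_pairs_mem:
  assumes q: "q \<in> E2" and B: "\<And>k. B \<in> push k q"
  shows "ap_pairs S l B \<in> q"
proof -
  note qu = ufs_near0_subset[OF q]
  have "S \<times> S \<inter> (\<Inter>k\<in>{..<l}. {z \<in> S \<times> S. lin k z \<in> B}) \<in> q"
    using B by (intro uf_INT[OF qu]) (simp_all add: uf_map_def)
  \<comment> \<open>The pairs generating a progression in \<open>B\<close> form a finite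
    intersection of preimages of \<open>B\<close>, one for each term.\<close>
  moreover have "S \<times> S \<inter> (\<Inter>k\<in>{..<l}. {z \<in> S \<times> S. lin k z \<in> B}) = ap_pairs S l B"
    by (auto simp: ap_pairs_def lin_def image_subset_iff)
  ultimately show ?thesis by simp
qed

lemma ap_pairs_subset: "ap_pairs S l B \<subseteq> S \<times> S"
  by (auto simp: ap_pairs_def)

text \<open>The common argument for the three dual notions. A large \<open>C\<close> lies in some
  \<open>q\<close> whose images consist of large sets. Such images must contain \<open>B\<close>, so
  \<open>q\<close> contains both \<open>ap_pairs S l B\<close> and \<open>C\<close>, which therefore
  meet.\<close>

lemma star_ap_pairs:
  assumes large: "\<And>C. P2 ({0..} \<times> {0..}) (S \<times> S) C \<Longrightarrow>
      \<exists>q\<in>E2. C \<in> q \<and> (\<forall>k. \<forall>A\<in>push k q. P1 {0..} S A)"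
    and B: "star P1 {0..} S B"
  shows "star P2 ({0..} \<times> {0..}) (S \<times> S) (ap_pairs S l B)"
  unfolding star_def
proof (intro conjI allI impI ap_pairs_subset)
  fix C assume "C \<subseteq> S \<times> S \<and> P2 ({0..} \<times> {0..}) (S \<times> S) C"
  then obtain q where q: "q \<in> E2" "C \<in> q" and P1: "\<And>k A. A \<in> push k q \<Longrightarrow> P1 {0..} S A"
    using large by blast
  have "B \<in> push k q" for k
  \<comment> \<open>Were \<open>B\<close> missing, its complement would be large and yet disjoint
    from \<open>B\<close>.\<close>
  proof (rule ccontr)
    have BS: "B \<subseteq> S" using B by (simp add: star_def)
    assume "B \<notin> push k q"
    then have "S - B \<in> push k q"
      using uf_Diff_iff[OF ufs_near0_subset[OF push_near[OF q(1)]] BS] by simp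
    then have "P1 {0..} S (S - B)" by (rule P1)
    then have "B \<inter> (S - B) \<noteq> {}"
      using B unfolding star_def by (meson Diff_subset)
    then show False by simp
  qed
  then have "ap_pairs S l B \<inter> C \<in> q"
    using uf_Int[OF ufs_near0_subset[OF q(1)] ap_pairs_mem[OF q(1)] q(2)] by blast
  then show "ap_pairs S l B \<inter> C \<noteq> {}" by (rule uf_nonempty[OF ufs_near0_subset[OF q(1)]])
qed

lemma central_ap_pairs:
  assumes "central_near0 {0..} S B"
  shows "central_near0 ({0..} \<times> {0..}) (S \<times> S) (ap_pairs S l B)"
proof -
  obtain p where p: "p \<in> K1" "uf_add S p p = p" "B \<in> p"
    using assms by (auto simp: central_near0_def)
  obtain q where q: "q \<in> K2" "uf_add (S \<times> S) q q = q" "\<And>k. push k q = p"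
    using smallest_ideal_lift_idempotent[OF p(1,2)] by blast
  have "ap_pairs S l B \<in> q"
    using q(1) P.smallest_ideal_near0 p(3) by (intro ap_pairs_mem) (auto simp: q(3))
  then show ?thesis using q(1,2) ap_pairs_subset by (auto simp: central_near0_def)
qed

lemma ps_ap_pairs:
  assumes "ps_near0 {0..} S B"
  shows "ps_near0 ({0..} \<times> {0..}) (S \<times> S) (ap_pairs S l B)"
proof -
  obtain p where p: "p \<in> K1" "B \<in> p"
    using R.smallest_ideal_if_ps_near0[OF assms] by blast
  obtain L q where L: "P.minimal_left_ideal L" "q \<in> L" "\<And>k. push k q = p"
    using smallest_ideal_lift[OF p(1)] by blast
  have q: "q \<in> K2" using L(1,2) P.smallest_ideal_eq by auto
  have "ap_pairs S l B \<in> q"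
    using q P.smallest_ideal_near0 p(2) by (intro ap_pairs_mem) (auto simp: L(3))
  then show ?thesis by (rule P.ps_near0_if_smallest_ideal[OF q])
qed

text \<open>\<open>push k\<close> is a homomorphism that maps \<open>K2\<close> into
  \<open>K1\<close>, so it carries minimal idempotents to minimal idempotents.\<close>

lemma star_central_ap_pairs:
  assumes "star central_near0 {0..} S B"
  shows "star central_near0 ({0..} \<times> {0..}) (S \<times> S) (ap_pairs S l B)"
proof (rule star_ap_pairs[OF _ assms])
  fix C assume "central_near0 ({0..} \<times> {0..}) (S \<times> S) C"
  then obtain q where q: "q \<in> K2" "uf_add (S \<times> S) q q = q" "C \<in> q"
    by (auto simp: central_near0_def)
  have qE: "q \<in> E2" using q(1) P.smallest_ideal_near0 by blast
  have "central_near0 {0..} S A" if "A \<in> push k q" for k A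
    using push_smallest_ideal[OF q(1)] push_add[of k q q] q(2) that
      uf_subset[OF ufs_near0_subset[OF push_near[OF qE]] that]
    unfolding central_near0_def by auto
  then show "\<exists>q\<in>E2. C \<in> q \<and> (\<forall>k. \<forall>A\<in>push k q. central_near0 {0..} S A)"
    using qE q(3) by blast
qed

lemma star_ps_ap_pairs:
  assumes "star ps_near0 {0..} S B"
  shows "star ps_near0 ({0..} \<times> {0..}) (S \<times> S) (ap_pairs S l B)"
proof (rule star_ap_pairs[OF _ assms])
  fix C assume "ps_near0 ({0..} \<times> {0..}) (S \<times> S) C"
  then obtain q where q: "q \<in> K2" "C \<in> q" by (rule P.smallest_ideal_if_ps_near0)
  have "ps_near0 {0..} S A" if "A \<in> push k q" for k A
    using R.ps_near0_if_smallest_ideal[OF push_smallest_ideal[OF q(1)] that] .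
  then show "\<exists>q\<in>E2. C \<in> q \<and> (\<forall>k. \<forall>A\<in>push k q. ps_near0 {0..} S A)"
    using q P.smallest_ideal_near0 by blast
qed

text \<open>Here \<open>q\<close> is an idempotent of \<open>E2\<close>, and its image under the
  homomorphism \<open>push k\<close> is an idempotent, all of whose members are IP near
  zero.\<close>

lemma star_ip_ap_pairs:
  assumes "star ip_near0 {0..} S B"
  shows "star ip_near0 ({0..} \<times> {0..}) (S \<times> S) (ap_pairs S l B)"
proof (rule star_ap_pairs[OF _ assms])
  fix C assume "ip_near0 ({0..} \<times> {0..}) (S \<times> S) C"
  then obtain q where q: "q \<in> E2" "uf_add (S \<times> S) q q = q" "C \<in> q"
    by (rule P.idempotent_if_ip_near0)
  have "ip_near0 {0..} S A" if "A \<in> push k q" for k A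
    using R.ip_near0_if_idempotent[OF push_near[OF q(1)] _ that] push_add[of k q q] q(2) by simp
  then show "\<exists>q\<in>E2. C \<in> q \<and> (\<forall>k. \<forall>A\<in>push k q. ip_near0 {0..} S A)"
    using q by blast
qed

end

theorem theorem3p14:
  fixes S B :: "real set" and l :: nat
  assumes "S \<subseteq> {0<..}"
    and "\<forall>x \<in> S. \<forall>y \<in> S. x + y \<in> S"
    and "0 \<in> closure S"
    and "l \<ge> 1"
    and "B \<subseteq> S"
  shows
    "(central_near0 {0..} S B \<longrightarrow>
        central_near0 ({0..} \<times> {0..}) (S \<times> S) (ap_pairs S l B)) \<and>
     (ps_near0 {0..} S B \<longrightarrow>
        ps_near0 ({0..} \<times> {0..}) (S \<times> S) (ap_pairs S l B)) \<and>
     (star central_near0 {0..} S B \<longrightarrow>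
        star central_near0 ({0..} \<times> {0..}) (S \<times> S) (ap_pairs S l B)) \<and>
     (star ps_near0 {0..} S B \<longrightarrow>
        star ps_near0 ({0..} \<times> {0..}) (S \<times> S) (ap_pairs S l B)) \<and>
     (star ip_near0 {0..} S B \<longrightarrow>
        star ip_near0 ({0..} \<times> {0..}) (S \<times> S) (ap_pairs S l B))"
proof -
  interpret near_zero_reals S
    using assms(1-3) by unfold_locales auto
  show ?thesis
    by (intro conjI impI central_ap_pairs ps_ap_pairs star_central_ap_pairs star_ps_ap_pairs
        star_ip_ap_pairs)
qed

end
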